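(* Let $\mathcal{C}$ be a semi-abelian category. If $\mathcal{C}$ satisfies (NH), then for each object $X$ of $\mathcal{C}$ the commutator $[X,X]=[X,X]_X$ is a characteristic subobject of $X$.
   Context: A semi-abelian category is a pointed, Barr-exact, Bourn-protomodular category with binary coproducts. $K\leq X$ means that $K$ is a subobject of $X$; $K\lhd X$ means that $K$ is a normal subobject, i.e. represented by a kernel. Two morphisms $f\colon A\to C$, $g\colon B\to C$ commute if there is a (necessarily unique) $\varphi\colon A\times B\to C$ with $\varphi\circ\langle 1_A,0\rangle=f$ and $\varphi\circ\langle 0,1_B\rangle=g$. For subobjects $k\colon K\to X$, $l\colon L\to X$, the Huq commutator $[K,L]_X\lhd X$ is the smallest normal subobject of $X$ such that the images of $k$ and $l$ in the quotient $X/[K,L]_X$ commute. The Higgins commutator $[K,L]\leq X$ is the regular image of the composite $K\diamond L\to K+L\to X$, where $K\diamond L\to K+L$ is the kernel of the canonical morphism $K+L\to K\times L$ (which is $\langle 1_K,0\rangle$ on $K$ and $\langle 0,1_L\rangle$ on $L$) and $K+L\to X$ is induced by $k$ and $l$. (NH): for each pair of normal subobjects $K,L\lhd X$ of an object $X$, the Higgins commutator $[K,L]\leq X$ is normal in $X$. For objects $B$, $X$, let $\kappa_{B,X}\colon B\flat X\to B+X$ be the kernel of the morphism $B+X\to B$ which is $1_B$ on $B$ and $0$ on $X$. The functor $B\flat(-)$ is a monad on $\mathcal{C}$, with unit $X\to B\flat X$ induced by the coproduct inclusion $X\to B+X$ and multiplication $B\flat(B\flat X)\to B\flat X$ induced by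 the morphism $B+(B\flat X)\to B+X$ that is the coproduct inclusion on $B$ and $\kappa_{B,X}$ on $B\flat X$. An action of $B$ on $X$ is an algebra structure $B\flat X\to X$ for this monad. A subobject $S\leq X$ is characteristic when, for every object $B$, every action $B\flat X\to X$ restricts to an action $B\flat S\to S$ (i.e. there is an action $B\flat S\to S$ making the inclusion $S\to X$ a morphism of algebras). *)

theory Defs
  imports Main
begin

text \<open>
  Categories are given by a set of objects and a set of arrows; composition is written in the
  applicative order, so that \<open>g \<cdot> f\<close> is "g after f". Functions are only meaningful on
  objects and composable arrows.
\<close>

record ('o, 'm) cat =
  Obj :: "'o set"
  Arr :: "'m set"
  Dom :: "'m \<Rightarrow> 'o"
  Cod :: "'m \<Rightarrow> 'o"
  Ident :: "'o \<Rightarrow> 'm"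
  Comp :: "'m \<Rightarrow> 'm \<Rightarrow> 'm"  (infixr "\<cdot>\<index>" 70)

definition hom :: "('o, 'm) cat \<Rightarrow> 'o \<Rightarrow> 'o \<Rightarrow> 'm set" where
  "hom C A B = {f \<in> Arr C. Dom C f = A \<and> Cod C f = B}"

locale category =
  fixes C :: "('o, 'm) cat" (structure)
  assumes Dom_closed: "f \<in> Arr C \<Longrightarrow> Dom C f \<in> Obj C"
    and Cod_closed: "f \<in> Arr C \<Longrightarrow> Cod C f \<in> Obj C"
    and Ident_closed: "A \<in> Obj C \<Longrightarrow> Ident C A \<in> hom C A A"
    and Comp_closed: "\<lbrakk>f \<in> hom C A B; g \<in> hom C B D\<rbrakk> \<Longrightarrow> g \<cdot> f \<in> hom C A D"
    and Comp_Ident: "f \<in> hom C A B \<Longrightarrow> f \<cdot> Ident C A = f"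
    and Ident_Comp: "f \<in> hom C A B \<Longrightarrow> Ident C B \<cdot> f = f"
    and Comp_assoc: "\<lbrakk>f \<in> hom C A B; g \<in> hom C B D; h \<in> hom C D E\<rbrakk>
      \<Longrightarrow> (h \<cdot> g) \<cdot> f = h \<cdot> (g \<cdot> f)"
begin

definition monic :: "'m \<Rightarrow> bool" where
  "monic m \<longleftrightarrow> m \<in> Arr C \<and>
    (\<forall>A. \<forall>f \<in> hom C A (Dom C m). \<forall>g \<in> hom C A (Dom C m). m \<cdot> f = m \<cdot> g \<longrightarrow> f = g)"

definition iso :: "'m \<Rightarrow> bool" where
  "iso f \<longleftrightarrow> f \<in> Arr C \<and>
    (\<exists>g \<in> hom C (Cod C f) (Dom C f). g \<cdot> f = Ident C (Dom C f) \<and> f \<cdot> g = Ident C (Cod C f))"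

definition is_initial :: "'o \<Rightarrow> bool" where
  "is_initial Z \<longleftrightarrow> Z \<in> Obj C \<and> (\<forall>A \<in> Obj C. \<exists>!f. f \<in> hom C Z A)"

definition is_terminal :: "'o \<Rightarrow> bool" where
  "is_terminal Z \<longleftrightarrow> Z \<in> Obj C \<and> (\<forall>A \<in> Obj C. \<exists>!f. f \<in> hom C A Z)"

definition is_product :: "'o \<Rightarrow> 'o \<Rightarrow> 'm \<Rightarrow> 'm \<Rightarrow> bool" where
  "is_product A B p q \<longleftrightarrow> (\<exists>P. p \<in> hom C P A \<and> q \<in> hom C P B \<and>
    (\<forall>Z. \<forall>f \<in> hom C Z A. \<forall>g \<in> hom C Z B. \<exists>!h. h \<in> hom C Z P \<and> p \<cdot> h = f \<and> q \<cdot> h = g))"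

definition is_coproduct :: "'o \<Rightarrow> 'o \<Rightarrow> 'm \<Rightarrow> 'm \<Rightarrow> bool" where
  "is_coproduct A B i j \<longleftrightarrow> (\<exists>P. i \<in> hom C A P \<and> j \<in> hom C B P \<and>
    (\<forall>Z. \<forall>f \<in> hom C A Z. \<forall>g \<in> hom C B Z. \<exists>!h. h \<in> hom C P Z \<and> h \<cdot> i = f \<and> h \<cdot> j = g))"

definition is_pullback :: "'m \<Rightarrow> 'm \<Rightarrow> 'm \<Rightarrow> 'm \<Rightarrow> bool" where
  "is_pullback f g p q \<longleftrightarrow> f \<in> Arr C \<and> g \<in> Arr C \<and> Cod C f = Cod C g \<and>
    (\<exists>P. p \<in> hom C P (Dom C f) \<and> q \<in> hom C P (Dom C g) \<and> f \<cdot> p = g \<cdot> q \<and>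
      (\<forall>Z. \<forall>a \<in> hom C Z (Dom C f). \<forall>b \<in> hom C Z (Dom C g). f \<cdot> a = g \<cdot> b \<longrightarrow>
        (\<exists>!u. u \<in> hom C Z P \<and> p \<cdot> u = a \<and> q \<cdot> u = b)))"

definition is_kernel_pair :: "'m \<Rightarrow> 'm \<Rightarrow> 'm \<Rightarrow> bool" where
  "is_kernel_pair f p q \<longleftrightarrow> is_pullback f f p q"

definition is_coequalizer :: "'m \<Rightarrow> 'm \<Rightarrow> 'm \<Rightarrow> bool" where
  "is_coequalizer f g q \<longleftrightarrow> (\<exists>A B Q. f \<in> hom C A B \<and> g \<in> hom C A B \<and> q \<in> hom C B Q \<and>
    q \<cdot> f = q \<cdot> g \<and>
    (\<forall>Z. \<forall>h \<in> hom C B Z. h \<cdot> f = h \<cdot> g \<longrightarrow> (\<exists>!u. u \<in> hom C Q Z \<and> u \<cdot> q = h)))"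

definition regular_epi :: "'m \<Rightarrow> bool" where
  "regular_epi q \<longleftrightarrow> (\<exists>f g. is_coequalizer f g q)"

text \<open>\<open>m\<close> represents the regular image of \<open>f\<close>.\<close>

definition is_image :: "'m \<Rightarrow> 'm \<Rightarrow> bool" where
  "is_image f m \<longleftrightarrow> f \<in> Arr C \<and> monic m \<and>
    (\<exists>e \<in> hom C (Dom C f) (Dom C m). regular_epi e \<and> f = m \<cdot> e)"

definition is_zero_object :: "'o \<Rightarrow> bool" where
  "is_zero_object Z \<longleftrightarrow> is_initial Z \<and> is_terminal Z"

definition pointed :: bool where
  "pointed \<longleftrightarrow> (\<exists>Z. is_zero_object Z)"

definition finitely_complete :: bool where
  "finitely_complete \<longleftrightarrow> (\<exists>Z. is_terminal Z) \<and>
    (\<forall>f \<in> Arr C. \<forall>g \<in> Arr C. Cod C f = Cod C g \<longrightarrow> (\<exists>p q. is_pullback f g p q))"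

definition binary_coproducts :: bool where
  "binary_coproducts \<longleftrightarrow> (\<forall>A \<in> Obj C. \<forall>B \<in> Obj C. \<exists>i j. is_coproduct A B i j)"

definition regular :: bool where
  "regular \<longleftrightarrow> finitely_complete \<and>
    (\<forall>f p q. is_kernel_pair f p q \<longrightarrow> (\<exists>e. is_coequalizer p q e)) \<and>
    (\<forall>f e p q. is_pullback f e p q \<longrightarrow> regular_epi e \<longrightarrow> regular_epi p)"

text \<open>Internal equivalence relations \<open>(r, s) : R \<rightrightarrows> X\<close>.\<close>

definition equivalence_relation :: "'m \<Rightarrow> 'm \<Rightarrow> bool" where
  "equivalence_relation r s \<longleftrightarrow> (\<exists>R X. r \<in> hom C R X \<and> s \<in> hom C R X \<and>
    (\<forall>A. \<forall>f \<in> hom C A R. \<forall>g \<in> hom C A R. r \<cdot> f = r \<cdot> g \<and> s \<cdot> f = s \<cdot> g \<longrightarrow> f = g) \<and>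
    (\<exists>d \<in> hom C X R. r \<cdot> d = Ident C X \<and> s \<cdot> d = Ident C X) \<and>
    (\<exists>t \<in> hom C R R. r \<cdot> t = s \<and> s \<cdot> t = r) \<and>
    (\<forall>p q. is_pullback s r p q \<longrightarrow> (\<exists>t \<in> hom C (Dom C p) R. r \<cdot> t = r \<cdot> p \<and> s \<cdot> t = s \<cdot> q)))"

definition barr_exact :: bool where
  "barr_exact \<longleftrightarrow> regular \<and>
    (\<forall>r s. equivalence_relation r s \<longrightarrow> (\<exists>f. is_kernel_pair f r s))"

text \<open>A point over \<open>I\<close> is a split epimorphism with codomain \<open>I\<close> together with a chosen section.\<close>

definition is_point :: "'o \<Rightarrow> 'm \<Rightarrow> 'm \<Rightarrow> bool" where
  "is_point I p s \<longleftrightarrow> (\<exists>A. p \<in> hom C A I \<and> s \<in> hom C I A \<and> p \<cdot> s = Ident C I)"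

definition point_hom :: "'m \<Rightarrow> 'm \<Rightarrow> 'm \<Rightarrow> 'm \<Rightarrow> 'm \<Rightarrow> bool" where
  "point_hom p s p' s' h \<longleftrightarrow> h \<in> hom C (Dom C p) (Dom C p') \<and> p' \<cdot> h = p \<and> h \<cdot> s = s'"

text \<open>
  Bourn-protomodularity: for every \<open>v : J \<rightarrow> I\<close>, the change-of-base functor \<open>v\<^sup>*\<close> from points
  over \<open>I\<close> to points over \<open>J\<close> reflects isomorphisms. Here \<open>b\<close> and \<open>b'\<close> are the pullbacks of
  \<open>p\<close> and \<open>p'\<close> along \<open>v\<close>, and \<open>u\<close> is \<open>v\<^sup>* h\<close>; it is automatically compatible with the induced
  sections, and a morphism of points is invertible as such as soon as it is invertible in \<open>C\<close>.
\<close>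

definition protomodular :: bool where
  "protomodular \<longleftrightarrow> (\<forall>J I v p s p' s' h a b a' b' u.
    v \<in> hom C J I \<and> is_point I p s \<and> is_point I p' s' \<and> point_hom p s p' s' h \<and>
    is_pullback v p b a \<and> is_pullback v p' b' a' \<and>
    u \<in> hom C (Dom C b) (Dom C b') \<and> b' \<cdot> u = b \<and> a' \<cdot> u = h \<cdot> a \<and> iso u \<longrightarrow> iso h)"

text \<open>
  Chosen finite (co)products and kernels. They are unspecified when the (co)limit in question does
  not exist, and unique up to isomorphism otherwise.
\<close>

definition zero :: "'o \<Rightarrow> 'o \<Rightarrow> 'm" where
  "zero A B = (THE f. \<exists>Z. is_zero_object Z \<and> (\<exists>a \<in> hom C A Z. \<exists>b \<in> hom C Z B. f = b \<cdot> a))"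

definition prod_projs :: "'o \<Rightarrow> 'o \<Rightarrow> 'm \<times> 'm" where
  "prod_projs A B = (SOME (p, q). is_product A B p q)"

definition prod :: "'o \<Rightarrow> 'o \<Rightarrow> 'o" where
  "prod A B = Dom C (fst (prod_projs A B))"

definition pair :: "'m \<Rightarrow> 'm \<Rightarrow> 'm" where
  "pair f g = (let (p, q) = prod_projs (Cod C f) (Cod C g) in
    THE h. h \<in> hom C (Dom C f) (prod (Cod C f) (Cod C g)) \<and> p \<cdot> h = f \<and> q \<cdot> h = g)"

definition coprod_injs :: "'o \<Rightarrow> 'o \<Rightarrow> 'm \<times> 'm" where
  "coprod_injs A B = (SOME (i, j). is_coproduct A B i j)"

definition inj1 :: "'o \<Rightarrow> 'o \<Rightarrow> 'm" where
  "inj1 A B = fst (coprod_injs A B)"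

definition inj2 :: "'o \<Rightarrow> 'o \<Rightarrow> 'm" where
  "inj2 A B = snd (coprod_injs A B)"

definition coprod :: "'o \<Rightarrow> 'o \<Rightarrow> 'o" where
  "coprod A B = Cod C (inj1 A B)"

definition copair :: "'m \<Rightarrow> 'm \<Rightarrow> 'm" where
  "copair f g = (THE h. h \<in> hom C (coprod (Dom C f) (Dom C g)) (Cod C f) \<and>
    h \<cdot> inj1 (Dom C f) (Dom C g) = f \<and> h \<cdot> inj2 (Dom C f) (Dom C g) = g)"

definition is_kernel :: "'m \<Rightarrow> 'm \<Rightarrow> bool" where
  "is_kernel f k \<longleftrightarrow> (\<exists>K A B. f \<in> hom C A B \<and> k \<in> hom C K A \<and> f \<cdot> k = zero K B \<and>
    (\<forall>Z. \<forall>h \<in> hom C Z A. f \<cdot> h = zero Z B \<longrightarrow> (\<exists>!u. u \<in> hom C Z K \<and> k \<cdot> u = h)))"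

definition is_cokernel :: "'m \<Rightarrow> 'm \<Rightarrow> bool" where
  "is_cokernel f q \<longleftrightarrow> (\<exists>A B Q. f \<in> hom C A B \<and> q \<in> hom C B Q \<and> q \<cdot> f = zero A Q \<and>
    (\<forall>Z. \<forall>h \<in> hom C B Z. h \<cdot> f = zero A Z \<longrightarrow> (\<exists>!u. u \<in> hom C Q Z \<and> u \<cdot> q = h)))"

definition ker :: "'m \<Rightarrow> 'm" where
  "ker f = (SOME k. is_kernel f k)"

definition factor :: "'m \<Rightarrow> 'm \<Rightarrow> 'm" where
  "factor k h = (THE u. u \<in> hom C (Dom C h) (Dom C k) \<and> k \<cdot> u = h)"

text \<open>
  Subobjects of \<open>X\<close> are represented by monomorphisms with codomain \<open>X\<close>. The predicates on
  monomorphisms below are invariant under isomorphism of subobjects.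
\<close>

definition subobj_le :: "'m \<Rightarrow> 'm \<Rightarrow> bool" where
  "subobj_le m n \<longleftrightarrow> (\<exists>u \<in> hom C (Dom C m) (Dom C n). n \<cdot> u = m)"

definition normal :: "'m \<Rightarrow> bool" where
  "normal k \<longleftrightarrow> (\<exists>f. is_kernel f k)"

definition commute :: "'m \<Rightarrow> 'm \<Rightarrow> bool" where
  "commute f g \<longleftrightarrow> (\<exists>A B D. f \<in> hom C A D \<and> g \<in> hom C B D \<and>
    (\<exists>\<phi> \<in> hom C (prod A B) D.
      \<phi> \<cdot> pair (Ident C A) (zero A B) = f \<and> \<phi> \<cdot> pair (zero B A) (Ident C B) = g))"

definition commute_modulo :: "'m \<Rightarrow> 'm \<Rightarrow> 'm \<Rightarrow> bool" where
  "commute_modulo k l n \<longleftrightarrow> (\<exists>q k' l'. is_cokernel n q \<and>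
    is_image (q \<cdot> k) k' \<and> is_image (q \<cdot> l) l' \<and> commute k' l')"

definition is_huq_commutator :: "'m \<Rightarrow> 'm \<Rightarrow> 'm \<Rightarrow> bool" where
  "is_huq_commutator k l n \<longleftrightarrow>
    Cod C n = Cod C k \<and> normal n \<and> commute_modulo k l n \<and>
    (\<forall>n'. Cod C n' = Cod C k \<and> normal n' \<and> commute_modulo k l n' \<longrightarrow> subobj_le n n')"

definition coprod_to_prod :: "'o \<Rightarrow> 'o \<Rightarrow> 'm" where
  "coprod_to_prod K L = copair (pair (Ident C K) (zero K L)) (pair (zero L K) (Ident C L))"

definition is_higgins_commutator :: "'m \<Rightarrow> 'm \<Rightarrow> 'm \<Rightarrow> bool" where
  "is_higgins_commutator k l m \<longleftrightarrow>
    is_image (copair k l \<cdot> ker (coprod_to_prod (Dom C k) (Dom C l))) m"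

definition NH :: bool where
  "NH \<longleftrightarrow> (\<forall>k l m. normal k \<and> normal l \<and> Cod C k = Cod C l \<and> is_higgins_commutator k l m
    \<longrightarrow> normal m)"

text \<open>The monad \<open>B\<flat>(-)\<close> and its algebras.\<close>

definition flat_ker :: "'o \<Rightarrow> 'o \<Rightarrow> 'm" where
  "flat_ker B X = ker (copair (Ident C B) (zero X B))"

definition flat :: "'o \<Rightarrow> 'o \<Rightarrow> 'o" where
  "flat B X = Dom C (flat_ker B X)"

definition flat_map :: "'o \<Rightarrow> 'm \<Rightarrow> 'm" where
  "flat_map B f = factor (flat_ker B (Cod C f))
    (copair (inj1 B (Cod C f)) (inj2 B (Cod C f) \<cdot> f) \<cdot> flat_ker B (Dom C f))"

definition flat_unit :: "'o \<Rightarrow> 'o \<Rightarrow> 'm" where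
  "flat_unit B X = factor (flat_ker B X) (inj2 B X)"

definition flat_mult :: "'o \<Rightarrow> 'o \<Rightarrow> 'm" where
  "flat_mult B X = factor (flat_ker B X)
    (copair (inj1 B X) (flat_ker B X) \<cdot> flat_ker B (flat B X))"

definition is_action :: "'o \<Rightarrow> 'o \<Rightarrow> 'm \<Rightarrow> bool" where
  "is_action B X \<xi> \<longleftrightarrow> \<xi> \<in> hom C (flat B X) X \<and>
    \<xi> \<cdot> flat_unit B X = Ident C X \<and> \<xi> \<cdot> flat_mult B X = \<xi> \<cdot> flat_map B \<xi>"

definition characteristic :: "'m \<Rightarrow> bool" where
  "characteristic s \<longleftrightarrow> monic s \<and>
    (\<forall>B \<in> Obj C. \<forall>\<xi>. is_action B (Cod C s) \<xi> \<longrightarrow>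
      (\<exists>\<zeta>. is_action B (Dom C s) \<zeta> \<and> s \<cdot> \<zeta> = \<xi> \<cdot> flat_map B s))"

end

locale semi_abelian_category = category +
  assumes pointed: pointed
    and barr_exact: barr_exact
    and protomodular: protomodular
    and binary_coproducts: binary_coproducts

end

theory Submission
  imports Defs
begin

text \<open>
  For groups the argument is classical. An action of \<open>B\<close> on \<open>X\<close> is conjugation inside the semidirect
  product \<open>A\<close> of \<open>X\<close> and \<open>B\<close>, in which \<open>X\<close> is normal. The commutator of \<open>X\<close> with itself is the same
  whether it is formed in \<open>X\<close> or in \<open>A\<close>, and it is normal in \<open>A\<close> by (NH). Hence conjugation by
  elements of \<open>B\<close> restricts to it. The lemmas \<open>semidirect_product\<close>, \<open>higgins_of_monic\<close> and
  \<open>action_restricts\<close> carry this over to a semi-abelian category.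

  The substantial part is the existence of the semidirect product. It is built as a quotient of
  \<open>B + X\<close> by a reflexive relation. Protomodularity says that a split epimorphism is generated by its
  kernel and its section (\<open>point_generated\<close>). It follows that relations are difunctional
  (\<open>difunctional\<close>), so that reflexive ones are equivalence relations and, by exactness, kernel
  pairs. This makes it possible to describe which elements the quotient identifies and to see, from
  the laws of the action, that \<open>X\<close> embeds as the kernel of the projection to \<open>B\<close>.

  That the Higgins and the Huq commutator of \<open>X\<close> with itself agree when the former is normal
  comes from another consequence of protomodularity: regular epimorphisms are cokernels of their
  kernels (\<open>regular_epi_coker\<close>). This applies to \<open>X + X \<rightarrow> X \<times> X\<close> and to the square
  \<open>q \<times> q\<close> of a quotient map, and it turns the vanishing of the commutator in a quotient \<open>Q\<close> of \<open>X\<close>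
  into a multiplication \<open>Q \<times> Q \<rightarrow> Q\<close> that is the identity on both axes.
\<close>

section \<open>Universal properties\<close>

context category
begin

lemma hom_iff [simp]: "f \<in> hom C A B \<longleftrightarrow> f \<in> Arr C \<and> Dom C f = A \<and> Cod C f = B"
  by (simp add: hom_def)

lemma comp_typing [simp]:
  assumes "f \<in> Arr C" "g \<in> Arr C" "Dom C g = Cod C f"
  shows "g \<cdot> f \<in> Arr C" "Dom C (g \<cdot> f) = Dom C f" "Cod C (g \<cdot> f) = Cod C g"
  using Comp_closed[of f "Dom C f" "Cod C f" g "Cod C g"] assms by auto

lemma ident_typing [simp]:
  assumes "A \<in> Obj C"
  shows "Ident C A \<in> Arr C" "Dom C (Ident C A) = A" "Cod C (Ident C A) = A"
  using Ident_closed[OF assms] by auto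

lemma comp_ident [simp]: "f \<in> Arr C \<Longrightarrow> Dom C f = A \<Longrightarrow> f \<cdot> Ident C A = f"
  using Comp_Ident by auto

lemma ident_comp [simp]: "f \<in> Arr C \<Longrightarrow> Cod C f = A \<Longrightarrow> Ident C A \<cdot> f = f"
  using Ident_Comp by auto

lemma comp_assoc [simp]:
  "\<lbrakk>f \<in> Arr C; g \<in> Arr C; h \<in> Arr C; Dom C g = Cod C f; Dom C h = Cod C g\<rbrakk>
    \<Longrightarrow> (h \<cdot> g) \<cdot> f = h \<cdot> g \<cdot> f"
  using Comp_assoc[of f "Dom C f" "Cod C f" g "Cod C g" h "Cod C h"] by simp

text \<open>
  Composites are normalised by associating to the right. There an equation \<open>g \<cdot> f = h\<close> can rewrite
  the middle of a longer composite only in the form below.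
\<close>

lemma reassoc:
  "\<lbrakk>g \<cdot> f = h; f \<in> Arr C; g \<in> Arr C; Dom C g = Cod C f; x \<in> Arr C; Dom C f = Cod C x\<rbrakk>
    \<Longrightarrow> g \<cdot> f \<cdot> x = h \<cdot> x"
  using comp_assoc[of x f g] by simp

lemma monicD:
  assumes "monic m" "m \<cdot> f = m \<cdot> g" "f \<in> Arr C" "g \<in> Arr C"
    "Cod C f = Dom C m" "Cod C g = Dom C m" "Dom C f = Dom C g"
  shows "f = g"
proof -
  have "f \<in> hom C (Dom C f) (Dom C m)" "g \<in> hom C (Dom C f) (Dom C m)" using assms(3-) by auto
  with assms(1,2) show ?thesis unfolding monic_def by blast
qed

lemma monic_arr: "monic m \<Longrightarrow> m \<in> Arr C"
  by (simp add: monic_def)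

lemma monicI:
  assumes "m \<in> Arr C"
    and "\<And>Z f g. \<lbrakk>f \<in> hom C Z (Dom C m); g \<in> hom C Z (Dom C m); m \<cdot> f = m \<cdot> g\<rbrakk> \<Longrightarrow> f = g"
  shows "monic m"
  using assms unfolding monic_def by blast

lemma isoE:
  assumes "iso f"
  obtains g where "f \<in> Arr C" "g \<in> hom C (Cod C f) (Dom C f)"
    "g \<cdot> f = Ident C (Dom C f)" "f \<cdot> g = Ident C (Cod C f)"
  using assms unfolding iso_def by blast

lemma monic_comp:
  assumes "monic m" "monic n" "Dom C n = Cod C m"
  shows "monic (n \<cdot> m)"
proof (rule monicI)
  have [simp]: "m \<in> Arr C" "n \<in> Arr C" using assms monic_arr by auto
  show "n \<cdot> m \<in> Arr C" using assms by simp
  fix Z f g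
  assume fg: "f \<in> hom C Z (Dom C (n \<cdot> m))" "g \<in> hom C Z (Dom C (n \<cdot> m))"
    and eq: "(n \<cdot> m) \<cdot> f = (n \<cdot> m) \<cdot> g"
  have "n \<cdot> m \<cdot> f = n \<cdot> m \<cdot> g" using fg eq assms(3) by simp
  then have "m \<cdot> f = m \<cdot> g" using monicD[OF assms(2)] fg assms(3) by simp
  then show "f = g" using monicD[OF assms(1)] fg assms(3) by simp
qed

lemma pullbackD:
  assumes "is_pullback f g p q"
  shows "f \<in> Arr C" "g \<in> Arr C" "Cod C f = Cod C g"
    "p \<in> Arr C" "q \<in> Arr C" "Dom C q = Dom C p" "Cod C p = Dom C f" "Cod C q = Dom C g"
    "f \<cdot> p = g \<cdot> q"
  using assms unfolding is_pullback_def by auto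

lemma pullback_factor:
  assumes "is_pullback f g p q" "a \<in> hom C Z (Dom C f)" "b \<in> hom C Z (Dom C g)" "f \<cdot> a = g \<cdot> b"
  obtains u where "u \<in> hom C Z (Dom C p)" "p \<cdot> u = a" "q \<cdot> u = b"
proof -
  from assms(1) obtain P where P: "p \<in> hom C P (Dom C f)"
    "\<forall>Z. \<forall>a \<in> hom C Z (Dom C f). \<forall>b \<in> hom C Z (Dom C g). f \<cdot> a = g \<cdot> b \<longrightarrow>
        (\<exists>!u. u \<in> hom C Z P \<and> p \<cdot> u = a \<and> q \<cdot> u = b)"
    unfolding is_pullback_def by blast
  have "Dom C p = P" using P(1) by simp
  moreover from P(2) assms(2-4) have "\<exists>!u. u \<in> hom C Z P \<and> p \<cdot> u = a \<and> q \<cdot> u = b" by blast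
  ultimately show ?thesis using that by blast
qed

lemma pullback_joint_monic:
  assumes "is_pullback f g p q" "u \<in> hom C Z (Dom C p)" "v \<in> hom C Z (Dom C p)"
    "p \<cdot> u = p \<cdot> v" "q \<cdot> u = q \<cdot> v"
  shows "u = v"
proof -
  note D = pullbackD[OF assms(1)]
  from assms(1) obtain P where P: "p \<in> hom C P (Dom C f)"
    "\<forall>Z. \<forall>a \<in> hom C Z (Dom C f). \<forall>b \<in> hom C Z (Dom C g). f \<cdot> a = g \<cdot> b \<longrightarrow>
        (\<exists>!u. u \<in> hom C Z P \<and> p \<cdot> u = a \<and> q \<cdot> u = b)"
    unfolding is_pullback_def by blast
  have PP: "P = Dom C p" using P(1) by simp
  have a: "p \<cdot> u \<in> hom C Z (Dom C f)" "q \<cdot> u \<in> hom C Z (Dom C g)" using D assms(2) by auto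
  have "f \<cdot> p \<cdot> u = (f \<cdot> p) \<cdot> u" using D(1-8) assms(2) by simp
  also have "\<dots> = g \<cdot> q \<cdot> u" using D assms(2) by simp
  finally have "\<exists>!x. x \<in> hom C Z P \<and> p \<cdot> x = p \<cdot> u \<and> q \<cdot> x = q \<cdot> u" using P(2) a by blast
  moreover have "u \<in> hom C Z P" "v \<in> hom C Z P" using assms(2,3) unfolding PP .
  ultimately show ?thesis using assms(4,5)[symmetric] by blast
qed

lemma coequalizerD:
  assumes "is_coequalizer f g q"
  shows "f \<in> Arr C" "g \<in> Arr C" "q \<in> Arr C" "Dom C g = Dom C f" "Cod C f = Dom C q"
    "Cod C g = Dom C q" "q \<cdot> f = q \<cdot> g"
  using assms unfolding is_coequalizer_def by auto

lemma coequalizer_unique_factor: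
  assumes "is_coequalizer f g q" "h \<in> Arr C" "Dom C h = Dom C q" "h \<cdot> f = h \<cdot> g"
  shows "\<exists>!u. u \<in> hom C (Cod C q) (Cod C h) \<and> u \<cdot> q = h"
proof -
  from assms(1) obtain B Q where AB: "q \<in> hom C B Q"
    "\<forall>Z. \<forall>h \<in> hom C B Z. h \<cdot> f = h \<cdot> g \<longrightarrow> (\<exists>!u. u \<in> hom C Q Z \<and> u \<cdot> q = h)"
    unfolding is_coequalizer_def by blast
  have "h \<in> hom C B (Cod C h)" "Q = Cod C q" using AB(1) assms(2,3) by auto
  with AB(2) assms(4) show ?thesis by blast
qed

lemma coequalizer_factor:
  assumes "is_coequalizer f g q" "h \<in> hom C (Dom C q) Z" "h \<cdot> f = h \<cdot> g"
  obtains u where "u \<in> hom C (Cod C q) Z" "u \<cdot> q = h"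
proof -
  have "h \<in> Arr C" "Dom C h = Dom C q" "Cod C h = Z" using assms(2) by simp_all
  with coequalizer_unique_factor[OF assms(1) this(1,2) assms(3)] that show ?thesis by blast
qed

lemma regular_epi_arr: "regular_epi q \<Longrightarrow> q \<in> Arr C"
  unfolding regular_epi_def using coequalizerD(3) by blast

lemma regular_epi_cancel:
  assumes "regular_epi q" "f \<cdot> q = g \<cdot> q" "f \<in> Arr C" "g \<in> Arr C"
    "Dom C f = Cod C q" "Dom C g = Cod C q" "Cod C f = Cod C g"
  shows "f = g"
proof -
  obtain a b where ab: "is_coequalizer a b q" using assms(1) unfolding regular_epi_def by blast
  note D = coequalizerD[OF ab]
  have "(f \<cdot> q) \<cdot> a = (f \<cdot> q) \<cdot> b" using D assms(3-7) by simp
  then have "\<exists>!u. u \<in> hom C (Cod C q) (Cod C (f \<cdot> q)) \<and> u \<cdot> q = f \<cdot> q"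
    using coequalizer_unique_factor[OF ab, of "f \<cdot> q"] D assms(3-7) by simp
  moreover have "f \<in> hom C (Cod C q) (Cod C (f \<cdot> q))" "g \<in> hom C (Cod C q) (Cod C (f \<cdot> q))"
    using D assms(3-7) by auto
  ultimately show ?thesis using assms(2)[symmetric] by blast
qed

text \<open>
  Regular epimorphisms are strong: \<open>u\<close> coequalises every pair that \<open>e\<close> coequalises, because
  \<open>m \<cdot> u\<close> does and \<open>m\<close> is monic, so \<open>u\<close> descends along \<open>e\<close>.
\<close>

lemma regular_epi_diagonal:
  assumes "regular_epi e" "monic m" "m \<cdot> u = v \<cdot> e" "u \<in> hom C (Dom C e) (Dom C m)"
    "v \<in> hom C (Cod C e) (Cod C m)"
  obtains w where "w \<in> hom C (Cod C e) (Dom C m)" "w \<cdot> e = u" "m \<cdot> w = v"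
proof -
  obtain a b where ab: "is_coequalizer a b e" using assms(1) unfolding regular_epi_def by blast
  note D = coequalizerD[OF ab]
  have m: "m \<in> Arr C" using assms(2) by (rule monic_arr)
  have "m \<cdot> u \<cdot> a = (m \<cdot> u) \<cdot> a" using D assms(4) m by simp
  also have "\<dots> = (v \<cdot> e) \<cdot> a" using assms by simp
  also have "\<dots> = (v \<cdot> e) \<cdot> b" using D assms(5) by simp
  also have "\<dots> = (m \<cdot> u) \<cdot> b" using assms by simp
  also have "\<dots> = m \<cdot> u \<cdot> b" using D assms(4) m by simp
  finally have ua: "u \<cdot> a = u \<cdot> b" using monicD[OF assms(2)] D assms(4) by simp
  obtain w where w: "w \<in> hom C (Cod C e) (Cod C u)" "w \<cdot> e = u"
    by (rule coequalizer_factor[OF ab, of u "Cod C u"]) (use ua assms(4) in \<open>simp_all\<close>)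
  have "(m \<cdot> w) \<cdot> e = v \<cdot> e" using w D m assms by simp
  then have "m \<cdot> w = v" 
    by (rule regular_epi_cancel[OF assms(1)]) (use w m D assms(4,5) in simp_all)
  then show ?thesis by (rule that[of w, rotated 2]) (use w assms(4) in simp_all)
qed

lemma regular_epi_iso_comp:
  assumes "regular_epi e" "iso i" "Dom C i = Cod C e"
  shows "regular_epi (i \<cdot> e)"
proof -
  obtain a b where ab: "is_coequalizer a b e" using assms(1) unfolding regular_epi_def by blast
  note D = coequalizerD[OF ab]
  obtain j where j: "i \<in> Arr C" "j \<in> hom C (Cod C i) (Dom C i)"
    "j \<cdot> i = Ident C (Dom C i)" "i \<cdot> j = Ident C (Cod C i)" by (rule isoE[OF assms(2)])
  have "is_coequalizer a b (i \<cdot> e)"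
    unfolding is_coequalizer_def
  proof (intro exI conjI allI ballI impI)
    show "a \<in> hom C (Dom C a) (Dom C e)" "b \<in> hom C (Dom C a) (Dom C e)"
      "i \<cdot> e \<in> hom C (Dom C e) (Cod C i)" using D j assms by auto
    show "(i \<cdot> e) \<cdot> a = (i \<cdot> e) \<cdot> b" using D j assms by simp
    fix Z h assume h: "h \<in> hom C (Dom C e) Z" "h \<cdot> a = h \<cdot> b"
    obtain u where u: "u \<in> hom C (Cod C e) Z" "u \<cdot> e = h"
      by (rule coequalizer_factor[OF ab h])
    show "\<exists>!u. u \<in> hom C (Cod C i) Z \<and> u \<cdot> i \<cdot> e = h"
    proof (rule ex1I[of _ "u \<cdot> j"])
      show "u \<cdot> j \<in> hom C (Cod C i) Z \<and> (u \<cdot> j) \<cdot> i \<cdot> e = h"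
        using u j D assms(3) by (simp add: reassoc[OF j(3)])
      fix v assume v: "v \<in> hom C (Cod C i) Z \<and> v \<cdot> i \<cdot> e = h"
      have "(v \<cdot> i) \<cdot> e = u \<cdot> e" using u v j D assms(3) by simp
      then have "v \<cdot> i = u"
        by (rule regular_epi_cancel[OF assms(1)]) (use u v j assms(3) in simp_all)
      then have "u \<cdot> j = (v \<cdot> i) \<cdot> j" by simp
      also have "\<dots> = v \<cdot> i \<cdot> j" by (rule comp_assoc) (use v j(1,2) in auto)
      also have "\<dots> = v" unfolding j(4) using v by simp
      finally show "v = u \<cdot> j" by simp
    qed
  qed
  then show ?thesis unfolding regular_epi_def by blast
qed

definition pr1 :: "'o \<Rightarrow> 'o \<Rightarrow> 'm" where
  "pr1 A B = fst (prod_projs A B)"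

definition pr2 :: "'o \<Rightarrow> 'o \<Rightarrow> 'm" where
  "pr2 A B = snd (prod_projs A B)"

end

section \<open>Zero morphisms, products, coproducts and kernels\<close>

context semi_abelian_category
begin

lemma Dom_obj [simp]: "f \<in> Arr C \<Longrightarrow> Dom C f \<in> Obj C"
  by (rule Dom_closed)

lemma Cod_obj [simp]: "f \<in> Arr C \<Longrightarrow> Cod C f \<in> Obj C"
  by (rule Cod_closed)

lemma hom_objs:
  assumes "f \<in> hom C A B"
  shows "A \<in> Obj C" "B \<in> Obj C"
  using assms by auto

lemma zero_object_exists:
  obtains Z where "is_zero_object Z" "Z \<in> Obj C"
  using pointed unfolding pointed_def is_zero_object_def is_initial_def by blast

lemma from_zero_object:
  assumes "is_zero_object Z" "A \<in> Obj C"
  obtains f where "f \<in> hom C Z A"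
  using assms unfolding is_zero_object_def is_initial_def by blast

lemma to_zero_object:
  assumes "is_zero_object Z" "A \<in> Obj C"
  obtains f where "f \<in> hom C A Z"
  using assms unfolding is_zero_object_def is_terminal_def by blast

lemma from_zero_object_unique:
  assumes "is_zero_object Z" "f \<in> hom C Z A" "g \<in> hom C Z A"
  shows "f = g"
  using assms hom_objs(2)[OF assms(2)] unfolding is_zero_object_def is_initial_def by blast

lemma to_zero_object_unique:
  assumes "is_zero_object Z" "f \<in> hom C A Z" "g \<in> hom C A Z"
  shows "f = g"
  using assms hom_objs(1)[OF assms(2)] unfolding is_zero_object_def is_terminal_def by blast

lemma zero_eqI:
  assumes "is_zero_object Z" "a \<in> hom C A Z" "b \<in> hom C Z B"
  shows "zero A B = b \<cdot> a"
  unfolding zero_def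
proof (rule the_equality)
  show "\<exists>Z. is_zero_object Z \<and> (\<exists>a' \<in> hom C A Z. \<exists>b' \<in> hom C Z B. b \<cdot> a = b' \<cdot> a')"
    using assms by blast
  fix f assume "\<exists>Z. is_zero_object Z \<and> (\<exists>a' \<in> hom C A Z. \<exists>b' \<in> hom C Z B. f = b' \<cdot> a')"
  then obtain Z' a' b' where Z': "is_zero_object Z'" "a' \<in> hom C A Z'" "b' \<in> hom C Z' B"
    "f = b' \<cdot> a'" by blast
  obtain t where t: "t \<in> hom C Z Z'"
    by (rule from_zero_object[OF assms(1) hom_objs(1)[OF Z'(3)]])
  have bt: "b' \<cdot> t = b"
    by (rule from_zero_object_unique[OF assms(1)]) (use t Z' assms in simp_all)
  have ta: "t \<cdot> a = a'"
    by (rule to_zero_object_unique[OF Z'(1)]) (use t Z' assms in simp_all)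
  have "b' \<cdot> t \<cdot> a = b \<cdot> a" by (rule reassoc[OF bt]) (use t Z' assms in simp_all)
  then show "f = b \<cdot> a" unfolding ta Z'(4) .
qed

lemma zero_factors:
  assumes "A \<in> Obj C" "B \<in> Obj C"
  obtains Z a b where "is_zero_object Z" "a \<in> hom C A Z" "b \<in> hom C Z B" "zero A B = b \<cdot> a"
proof -
  obtain Z where Z: "is_zero_object Z" by (rule zero_object_exists)
  obtain a where a: "a \<in> hom C A Z" by (rule to_zero_object[OF Z assms(1)])
  obtain b where b: "b \<in> hom C Z B" by (rule from_zero_object[OF Z assms(2)])
  from that[OF Z a b zero_eqI[OF Z a b]] show ?thesis .
qed

lemma zero_typing [simp]:
  assumes "A \<in> Obj C" "B \<in> Obj C"
  shows "zero A B \<in> Arr C" "Dom C (zero A B) = A" "Cod C (zero A B) = B"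
proof -
  obtain Z a b where "is_zero_object Z" "a \<in> hom C A Z" "b \<in> hom C Z B" "zero A B = b \<cdot> a"
    by (rule zero_factors[OF assms])
  then show "zero A B \<in> Arr C" "Dom C (zero A B) = A" "Cod C (zero A B) = B" by simp_all
qed

lemma zero_comp [simp]:
  assumes "f \<in> Arr C" "Cod C f = B" "D \<in> Obj C"
  shows "zero B D \<cdot> f = zero (Dom C f) D"
proof -
  have "B \<in> Obj C" using assms by auto
  then obtain Z a b where Z: "is_zero_object Z" "a \<in> hom C B Z" "b \<in> hom C Z D" "zero B D = b \<cdot> a"
    using zero_factors assms(3) by blast
  have "zero (Dom C f) D = b \<cdot> (a \<cdot> f)"
    by (rule zero_eqI[OF Z(1)]) (use Z assms in simp_all)
  then show ?thesis using Z assms by simp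
qed

lemma comp_zero [simp]:
  assumes "f \<in> Arr C" "Dom C f = B" "A \<in> Obj C"
  shows "f \<cdot> zero A B = zero A (Cod C f)"
proof -
  have "B \<in> Obj C" using assms by auto
  then obtain Z a b where Z: "is_zero_object Z" "a \<in> hom C A Z" "b \<in> hom C Z B" "zero A B = b \<cdot> a"
    using zero_factors assms(3) by blast
  have "zero A (Cod C f) = (f \<cdot> b) \<cdot> a"
    by (rule zero_eqI[OF Z(1)]) (use Z assms in simp_all)
  then show ?thesis using Z assms by simp
qed

lemma regular: regular
  using barr_exact unfolding barr_exact_def by blast

lemma pullback_exists:
  assumes "f \<in> Arr C" "g \<in> Arr C" "Cod C f = Cod C g"
  obtains p q where "is_pullback f g p q"
  using regular assms unfolding regular_def finitely_complete_def by blast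

lemma product_exists:
  assumes "A \<in> Obj C" "B \<in> Obj C"
  shows "\<exists>p q. is_product A B p q"
proof -
  obtain Z where Z: "is_zero_object Z" by (rule zero_object_exists)
  obtain a where a: "a \<in> hom C A Z" by (rule to_zero_object[OF Z assms(1)])
  obtain b where b: "b \<in> hom C B Z" by (rule to_zero_object[OF Z assms(2)])
  obtain p q where pb: "is_pullback a b p q" by (rule pullback_exists[of a b]) (use a b in auto)
  note D = pullbackD[OF pb]
  have "is_product A B p q"
    unfolding is_product_def
  proof (intro exI conjI allI ballI)
    show "p \<in> hom C (Dom C p) A" "q \<in> hom C (Dom C p) B" using D a b by simp_all
    fix W f g assume fg: "f \<in> hom C W A" "g \<in> hom C W B"
    have "a \<cdot> f = b \<cdot> g" by (rule to_zero_object_unique[OF Z]) (use fg a b in simp_all)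
    then obtain u where u: "u \<in> hom C W (Dom C p)" "p \<cdot> u = f" "q \<cdot> u = g"
      by (rule pullback_factor[OF pb, of f W g, rotated 2]) (use fg a b in simp_all)
    show "\<exists>!h. h \<in> hom C W (Dom C p) \<and> p \<cdot> h = f \<and> q \<cdot> h = g"
    proof (rule ex1I[of _ u])
      show "u \<in> hom C W (Dom C p) \<and> p \<cdot> u = f \<and> q \<cdot> u = g" using u by blast
      fix v assume "v \<in> hom C W (Dom C p) \<and> p \<cdot> v = f \<and> q \<cdot> v = g"
      then show "v = u" using u by (intro pullback_joint_monic[OF pb, of v W u]) simp_all
    qed
  qed
  then show ?thesis by blast
qed

lemma is_product_pr:
  assumes "A \<in> Obj C" "B \<in> Obj C"
  shows "is_product A B (pr1 A B) (pr2 A B)"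
proof -
  have "\<exists>x. case x of (p, q) \<Rightarrow> is_product A B p q" using product_exists[OF assms] by auto
  then have "case prod_projs A B of (p, q) \<Rightarrow> is_product A B p q"
    unfolding prod_projs_def by (rule someI_ex)
  then show ?thesis unfolding pr1_def pr2_def by (simp add: case_prod_beta)
qed

lemma pr_typing [simp]:
  assumes "A \<in> Obj C" "B \<in> Obj C"
  shows "pr1 A B \<in> Arr C" "Dom C (pr1 A B) = prod A B" "Cod C (pr1 A B) = A"
    "pr2 A B \<in> Arr C" "Dom C (pr2 A B) = prod A B" "Cod C (pr2 A B) = B"
  using is_product_pr[OF assms] unfolding is_product_def by (auto simp: prod_def pr1_def)

lemma prod_obj [simp]: "A \<in> Obj C \<Longrightarrow> B \<in> Obj C \<Longrightarrow> prod A B \<in> Obj C"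
  using Dom_obj[of "pr1 A B"] by simp

lemma pair_spec:
  assumes "f \<in> hom C Z A" "g \<in> hom C Z B"
  shows "\<exists>!h. h \<in> hom C Z (prod A B) \<and> pr1 A B \<cdot> h = f \<and> pr2 A B \<cdot> h = g"
    (is "Ex1 ?P") and "pair f g = (THE h. h \<in> hom C Z (prod A B) \<and> pr1 A B \<cdot> h = f \<and> pr2 A B \<cdot> h = g)"
proof -
  have AB: "A \<in> Obj C" "B \<in> Obj C" using assms by auto
  obtain P where P: "pr1 A B \<in> hom C P A"
    "\<forall>Z. \<forall>f \<in> hom C Z A. \<forall>g \<in> hom C Z B. \<exists>!h. h \<in> hom C Z P \<and> pr1 A B \<cdot> h = f \<and> pr2 A B \<cdot> h = g"
    using is_product_pr[OF AB] unfolding is_product_def by blast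
  have "P = prod A B" using P(1) AB by auto
  with P(2) assms show "Ex1 ?P" by blast
  show "pair f g = The ?P" using assms unfolding pair_def Let_def
    by (simp add: case_prod_beta pr1_def pr2_def)
qed

lemma pair_hom:
  assumes "f \<in> hom C Z A" "g \<in> hom C Z B"
  shows "pair f g \<in> hom C Z (prod A B) \<and> pr1 A B \<cdot> pair f g = f \<and> pr2 A B \<cdot> pair f g = g"
  unfolding pair_spec(2)[OF assms] by (rule theI'[OF pair_spec(1)[OF assms]])

lemma pair_typing [simp]:
  assumes "f \<in> Arr C" "g \<in> Arr C" "Dom C g = Dom C f"
  shows "pair f g \<in> Arr C" "Dom C (pair f g) = Dom C f" "Cod C (pair f g) = prod (Cod C f) (Cod C g)"
  using pair_hom[of f "Dom C f" "Cod C f" g "Cod C g"] assms by simp_all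

lemma pr_pair [simp]:
  assumes "f \<in> Arr C" "g \<in> Arr C" "Dom C g = Dom C f" "Cod C f = A" "Cod C g = B"
  shows "pr1 A B \<cdot> pair f g = f" "pr2 A B \<cdot> pair f g = g"
  using pair_hom[of f "Dom C f" A g B] assms by simp_all

lemma pr_pair_comp [simp]:
  assumes "f \<in> Arr C" "g \<in> Arr C" "Dom C g = Dom C f" "Cod C f = A" "Cod C g = B"
    "x \<in> Arr C" "Cod C x = Dom C f"
  shows "pr1 A B \<cdot> pair f g \<cdot> x = f \<cdot> x" "pr2 A B \<cdot> pair f g \<cdot> x = g \<cdot> x"
proof -
  have "A \<in> Obj C" "B \<in> Obj C" using assms by auto
  then show "pr1 A B \<cdot> pair f g \<cdot> x = f \<cdot> x" "pr2 A B \<cdot> pair f g \<cdot> x = g \<cdot> x"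
    using assms by (simp_all add: reassoc[of "pr1 A B"] reassoc[of "pr2 A B"])
qed

lemma prod_eqI:
  assumes "u \<in> hom C Z (prod A B)" "v \<in> hom C Z (prod A B)" "A \<in> Obj C" "B \<in> Obj C"
    "pr1 A B \<cdot> u = pr1 A B \<cdot> v" "pr2 A B \<cdot> u = pr2 A B \<cdot> v"
  shows "u = v"
proof -
  have "pr1 A B \<cdot> v \<in> hom C Z A" "pr2 A B \<cdot> v \<in> hom C Z B" using assms by simp_all
  from pair_spec(1)[OF this] assms show ?thesis by blast
qed

lemma pair_comp:
  assumes "f \<in> Arr C" "g \<in> Arr C" "Dom C g = Dom C f" "x \<in> Arr C" "Cod C x = Dom C f"
  shows "pair f g \<cdot> x = pair (f \<cdot> x) (g \<cdot> x)"
  by (rule prod_eqI[where Z = "Dom C x" and A = "Cod C f" and B = "Cod C g"]) (use assms in simp_all)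

lemma is_coproduct_inj:
  assumes "A \<in> Obj C" "B \<in> Obj C"
  shows "is_coproduct A B (inj1 A B) (inj2 A B)"
proof -
  have "\<exists>x. case x of (p, q) \<Rightarrow> is_coproduct A B p q"
    using binary_coproducts assms unfolding binary_coproducts_def by auto
  then have "case coprod_injs A B of (p, q) \<Rightarrow> is_coproduct A B p q"
    unfolding coprod_injs_def by (rule someI_ex)
  then show ?thesis unfolding inj1_def inj2_def by (simp add: case_prod_beta)
qed

lemma inj_typing [simp]:
  assumes "A \<in> Obj C" "B \<in> Obj C"
  shows "inj1 A B \<in> Arr C" "Dom C (inj1 A B) = A" "Cod C (inj1 A B) = coprod A B"
    "inj2 A B \<in> Arr C" "Dom C (inj2 A B) = B" "Cod C (inj2 A B) = coprod A B"
  using is_coproduct_inj[OF assms] unfolding is_coproduct_def by (auto simp: coprod_def)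

lemma coprod_obj [simp]: "A \<in> Obj C \<Longrightarrow> B \<in> Obj C \<Longrightarrow> coprod A B \<in> Obj C"
  using Cod_obj[of "inj1 A B"] by simp

lemma copair_spec:
  assumes "f \<in> hom C A Z" "g \<in> hom C B Z"
  shows "\<exists>!h. h \<in> hom C (coprod A B) Z \<and> h \<cdot> inj1 A B = f \<and> h \<cdot> inj2 A B = g"
    (is "Ex1 ?P") and "copair f g = (THE h. h \<in> hom C (coprod A B) Z \<and> h \<cdot> inj1 A B = f \<and> h \<cdot> inj2 A B = g)"
proof -
  have AB: "A \<in> Obj C" "B \<in> Obj C" using assms by auto
  obtain P where P: "inj1 A B \<in> hom C A P"
    "\<forall>Z. \<forall>f \<in> hom C A Z. \<forall>g \<in> hom C B Z. \<exists>!h. h \<in> hom C P Z \<and> h \<cdot> inj1 A B = f \<and> h \<cdot> inj2 A B = g"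
    using is_coproduct_inj[OF AB] unfolding is_coproduct_def by blast
  have "P = coprod A B" using P(1) AB by auto
  with P(2) assms show "Ex1 ?P" by blast
  show "copair f g = The ?P" using assms unfolding copair_def by simp
qed

lemma copair_hom:
  assumes "f \<in> hom C A Z" "g \<in> hom C B Z"
  shows "copair f g \<in> hom C (coprod A B) Z \<and> copair f g \<cdot> inj1 A B = f \<and> copair f g \<cdot> inj2 A B = g"
  unfolding copair_spec(2)[OF assms] by (rule theI'[OF copair_spec(1)[OF assms]])

lemma copair_typing [simp]:
  assumes "f \<in> Arr C" "g \<in> Arr C" "Cod C g = Cod C f"
  shows "copair f g \<in> Arr C" "Dom C (copair f g) = coprod (Dom C f) (Dom C g)"
    "Cod C (copair f g) = Cod C f"
  using copair_hom[of f "Dom C f" "Cod C f" g "Dom C g"] assms by simp_all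

lemma copair_inj [simp]:
  assumes "f \<in> Arr C" "g \<in> Arr C" "Cod C g = Cod C f" "Dom C f = A" "Dom C g = B"
  shows "copair f g \<cdot> inj1 A B = f" "copair f g \<cdot> inj2 A B = g"
  using copair_hom[of f A "Cod C f" g B] assms by simp_all

lemma copair_inj_comp [simp]:
  assumes "f \<in> Arr C" "g \<in> Arr C" "Cod C g = Cod C f" "Dom C f = A" "Dom C g = B" "x \<in> Arr C"
  shows "Cod C x = A \<Longrightarrow> copair f g \<cdot> inj1 A B \<cdot> x = f \<cdot> x"
    "Cod C x = B \<Longrightarrow> copair f g \<cdot> inj2 A B \<cdot> x = g \<cdot> x"
proof -
  have "A \<in> Obj C" "B \<in> Obj C" using assms by auto
  then show "Cod C x = A \<Longrightarrow> copair f g \<cdot> inj1 A B \<cdot> x = f \<cdot> x"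
    "Cod C x = B \<Longrightarrow> copair f g \<cdot> inj2 A B \<cdot> x = g \<cdot> x"
    using assms by (simp_all add: reassoc[of _ "inj1 A B"] reassoc[of _ "inj2 A B"])
qed

lemma coprod_eqI:
  assumes "u \<in> hom C (coprod A B) Z" "v \<in> hom C (coprod A B) Z" "A \<in> Obj C" "B \<in> Obj C"
    "u \<cdot> inj1 A B = v \<cdot> inj1 A B" "u \<cdot> inj2 A B = v \<cdot> inj2 A B"
  shows "u = v"
proof -
  have "v \<cdot> inj1 A B \<in> hom C A Z" "v \<cdot> inj2 A B \<in> hom C B Z" using assms by simp_all
  from copair_spec(1)[OF this] assms show ?thesis by blast
qed

lemma comp_copair:
  assumes "f \<in> Arr C" "g \<in> Arr C" "Cod C g = Cod C f" "x \<in> Arr C" "Dom C x = Cod C f"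
  shows "x \<cdot> copair f g = copair (x \<cdot> f) (x \<cdot> g)"
  by (rule coprod_eqI[where Z = "Cod C x" and A = "Dom C f" and B = "Dom C g"]) (use assms in simp_all)

lemma kernelD:
  assumes "is_kernel f k"
  shows "f \<in> Arr C" "k \<in> Arr C" "Cod C k = Dom C f" "f \<cdot> k = zero (Dom C k) (Cod C f)"
  using assms unfolding is_kernel_def by auto

lemma kernel_unique_factor:
  assumes "is_kernel f k" "h \<in> hom C Z (Dom C f)" "f \<cdot> h = zero Z (Cod C f)"
  shows "\<exists>!u. u \<in> hom C Z (Dom C k) \<and> k \<cdot> u = h"
proof -
  obtain K A B where K: "f \<in> hom C A B" "k \<in> hom C K A"
    "\<forall>Z. \<forall>h \<in> hom C Z A. f \<cdot> h = zero Z B \<longrightarrow> (\<exists>!u. u \<in> hom C Z K \<and> k \<cdot> u = h)"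
    using assms(1) unfolding is_kernel_def by blast
  then have "A = Dom C f" "B = Cod C f" "K = Dom C k" by auto
  with K(3) assms(2,3) show ?thesis by blast
qed

lemma kernel_factor:
  assumes "is_kernel f k" "h \<in> hom C Z (Dom C f)" "f \<cdot> h = zero Z (Cod C f)"
  obtains u where "u \<in> hom C Z (Dom C k)" "k \<cdot> u = h"
  using kernel_unique_factor[OF assms] by blast

lemma kernel_monic:
  assumes "is_kernel f k"
  shows "monic k"
proof (rule monicI)
  note D = kernelD[OF assms]
  show "k \<in> Arr C" by (rule D)
  fix Z u v assume uv: "u \<in> hom C Z (Dom C k)" "v \<in> hom C Z (Dom C k)" "k \<cdot> u = k \<cdot> v"
  have "f \<cdot> k \<cdot> u = zero (Dom C k) (Cod C f) \<cdot> u" using D uv(1) by (intro reassoc[of f k]) simp_all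
  then have "f \<cdot> k \<cdot> u = zero Z (Cod C f)" using uv(1) D by simp
  then have "\<exists>!x. x \<in> hom C Z (Dom C k) \<and> k \<cdot> x = k \<cdot> u"
    by (intro kernel_unique_factor[OF assms]) (use uv(1) D in simp_all)
  then show "u = v" using uv(1,2) uv(3)[symmetric] by blast
qed

lemma kernelI:
  assumes "f \<in> hom C A B" "monic k" "k \<in> hom C K A" "f \<cdot> k = zero K B"
    and "\<And>Z h. h \<in> hom C Z A \<Longrightarrow> f \<cdot> h = zero Z B \<Longrightarrow> \<exists>u. u \<in> hom C Z K \<and> k \<cdot> u = h"
  shows "is_kernel f k"
proof -
  have "\<exists>!u. u \<in> hom C Z K \<and> k \<cdot> u = h" if h: "h \<in> hom C Z A" "f \<cdot> h = zero Z B" for Z h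
  proof -
    have "u = v" if "u \<in> hom C Z K \<and> k \<cdot> u = h" "v \<in> hom C Z K \<and> k \<cdot> v = h" for u v
      by (rule monicD[OF assms(2)]) (use that assms(3) in simp_all)
    with assms(5)[OF h] show ?thesis by (rule ex_ex1I)
  qed
  then have "\<forall>Z. \<forall>h \<in> hom C Z A. f \<cdot> h = zero Z B \<longrightarrow> (\<exists>!u. u \<in> hom C Z K \<and> k \<cdot> u = h)"
    by (intro allI ballI impI)
  with assms(1,3,4) show ?thesis
    unfolding is_kernel_def by (intro exI[of _ K] exI[of _ A] exI[of _ B] conjI)
qed

lemma kernel_exists:
  assumes "f \<in> Arr C"
  shows "\<exists>k. is_kernel f k"
proof -
  obtain Z where Z: "is_zero_object Z" "Z \<in> Obj C" by (rule zero_object_exists)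
  obtain b where b: "b \<in> hom C Z (Cod C f)" by (rule from_zero_object[OF Z(1), of "Cod C f"]) (use assms in auto)
  obtain k z where pb: "is_pullback f b k z" by (rule pullback_exists[of f b]) (use assms b in auto)
  note D = pullbackD[OF pb]
  have fk: "f \<cdot> k = zero (Dom C k) (Cod C f)"
    unfolding D(9) by (rule zero_eqI[OF Z(1), symmetric]) (use D b in auto)
  have "is_kernel f k"
  proof (rule kernelI)
    show "f \<in> hom C (Dom C f) (Cod C f)" "k \<in> hom C (Dom C k) (Dom C f)" using D by simp_all
    show "f \<cdot> k = zero (Dom C k) (Cod C f)" by (rule fk)
    show "monic k"
    proof (rule monicI[OF D(4)])
      fix W u v assume uv: "u \<in> hom C W (Dom C k)" "v \<in> hom C W (Dom C k)" "k \<cdot> u = k \<cdot> v"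
      show "u = v"
      proof (rule pullback_joint_monic[OF pb uv])
        show "z \<cdot> u = z \<cdot> v"
          by (rule to_zero_object_unique[OF Z(1), of _ W]) (use uv D b in simp_all)
      qed
    qed
    fix W h assume h: "h \<in> hom C W (Dom C f)" "f \<cdot> h = zero W (Cod C f)"
    obtain c where c: "c \<in> hom C W Z" by (rule to_zero_object[OF Z(1) hom_objs(1)[OF h(1)]])
    have "f \<cdot> h = b \<cdot> c" unfolding h(2) by (rule zero_eqI[OF Z(1) c b])
    moreover have "c \<in> hom C W (Dom C b)" using b c by simp
    ultimately show "\<exists>u. u \<in> hom C W (Dom C k) \<and> k \<cdot> u = h"
      using pullback_factor[OF pb h(1)] by blast
  qed
  then show ?thesis by blast
qed

lemma is_kernel_ker: "f \<in> Arr C \<Longrightarrow> is_kernel f (ker f)"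
  unfolding ker_def by (rule someI_ex[OF kernel_exists])

lemma factor_spec:
  assumes "monic k" "u \<in> hom C (Dom C h) (Dom C k)" "k \<cdot> u = h"
  shows "factor k h \<in> hom C (Dom C h) (Dom C k)" "k \<cdot> factor k h = h"
proof -
  have "factor k h = u"
    unfolding factor_def
  proof (rule the_equality)
    fix v assume v: "v \<in> hom C (Dom C h) (Dom C k) \<and> k \<cdot> v = h"
    show "v = u" by (rule monicD[OF assms(1)]) (use v assms(2,3) in simp_all)
  qed (use assms(2,3) in blast)
  then show "factor k h \<in> hom C (Dom C h) (Dom C k)" "k \<cdot> factor k h = h" using assms by simp_all
qed

section \<open>Regular images\<close>

text \<open>
  In a regular category this replaces the choice of preimages of elements: an arrow into the
  codomain of a regular epimorphism \<open>e\<close> lifts along \<open>e\<close> once its domain is replaced by a cover \<open>z\<close>.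
  An equation of arrows that holds after composition with \<open>z\<close> holds already, as \<open>z\<close> is an
  epimorphism.
\<close>

lemma cover:
  assumes "regular_epi e" "c \<in> Arr C" "Cod C c = Cod C e"
  obtains Z z c' where "regular_epi z" "z \<in> hom C Z (Dom C c)" "c' \<in> hom C Z (Dom C e)"
    "e \<cdot> c' = c \<cdot> z"
proof -
  obtain z c' where pb: "is_pullback c e z c'"
    by (rule pullback_exists[of c e]) (use assms regular_epi_arr in simp_all)
  note D = pullbackD[OF pb]
  have "regular_epi z" using regular pb assms(1) unfolding regular_def by blast
  then show ?thesis
    by (rule that[of z "Dom C z" c']) (use D in simp_all)
qed

text \<open>
  Take for \<open>e\<close> the quotient by the kernel pair of \<open>f\<close>. If \<open>m \<cdot> a = m \<cdot> b\<close>, then on a common cover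
  \<open>a\<close> and \<open>b\<close> lift to arrows with the same composite with \<open>f\<close>. These form an arrow into the kernel
  pair, so that \<open>e\<close> identifies them, and therefore \<open>a = b\<close>.
\<close>

lemma image_exists:
  assumes "f \<in> Arr C"
  obtains m e where "monic m" "m \<in> hom C (Dom C m) (Cod C f)" "regular_epi e"
    "e \<in> hom C (Dom C f) (Dom C m)" "m \<cdot> e = f"
proof -
  obtain p q where pb: "is_pullback f f p q" by (rule pullback_exists[OF assms assms refl])
  note P = pullbackD[OF pb]
  have "\<exists>e. is_coequalizer p q e" using regular pb unfolding regular_def is_kernel_pair_def by blast
  then obtain e where ce: "is_coequalizer p q e" ..
  note D = coequalizerD[OF ce]
  have re: "regular_epi e" using ce unfolding regular_epi_def by blast
  have de: "Dom C e = Dom C f" using D P by simp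
  obtain m where m: "m \<in> hom C (Cod C e) (Cod C f)" "m \<cdot> e = f"
    by (rule coequalizer_factor[OF ce, of f "Cod C f"]) (use P de in simp_all)
  have "monic m"
  proof (rule monicI)
    show "m \<in> Arr C" using m by simp
    fix Z a b assume ab: "a \<in> hom C Z (Dom C m)" "b \<in> hom C Z (Dom C m)" "m \<cdot> a = m \<cdot> b"
    obtain Z1 z1 a1 where z1: "regular_epi z1" "z1 \<in> hom C Z1 Z" "a1 \<in> hom C Z1 (Dom C e)"
      "e \<cdot> a1 = a \<cdot> z1"
      by (rule cover[OF re, of a]) (use ab m in simp_all)
    obtain Z2 z2 b2 where z2: "regular_epi z2" "z2 \<in> hom C Z2 Z1" "b2 \<in> hom C Z2 (Dom C e)"
      "e \<cdot> b2 = (b \<cdot> z1) \<cdot> z2"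
      by (rule cover[OF re, of "b \<cdot> z1"]) (use ab m z1 in simp_all)
    have ez: "e \<cdot> a1 \<cdot> z2 = (a \<cdot> z1) \<cdot> z2"
      by (rule reassoc[OF z1(4)]) (use z1 z2 D in simp_all)
    have "f \<cdot> a1 \<cdot> z2 = m \<cdot> e \<cdot> a1 \<cdot> z2"
      unfolding m(2)[symmetric] using m(1) D z1 z2 by simp
    also have "\<dots> = (m \<cdot> a) \<cdot> z1 \<cdot> z2" unfolding ez using m(1) ab(1) z1(2) z2(2) by simp
    also have "\<dots> = m \<cdot> e \<cdot> b2"
      unfolding ab(3) z2(4) using m(1) ab(2) z1(2) z2(2) by simp
    also have "\<dots> = f \<cdot> b2"
      unfolding m(2)[symmetric] using m(1) D z2 by simp
    finally have "f \<cdot> a1 \<cdot> z2 = f \<cdot> b2" .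
    then obtain u where u: "u \<in> hom C Z2 (Dom C p)" "p \<cdot> u = a1 \<cdot> z2" "q \<cdot> u = b2"
      by (rule pullback_factor[OF pb, of "a1 \<cdot> z2" Z2 b2, rotated 2]) (use z1 z2 de in simp_all)
    have "e \<cdot> p \<cdot> u = (e \<cdot> q) \<cdot> u" by (rule reassoc[OF D(7)]) (use D u in simp_all)
    also have "\<dots> = e \<cdot> q \<cdot> u" using D u(1) by simp
    finally have "(a \<cdot> z1) \<cdot> z2 = (b \<cdot> z1) \<cdot> z2" unfolding u(2,3) ez z2(4) .
    then have "a \<cdot> z1 = b \<cdot> z1"
      by (rule regular_epi_cancel[OF z2(1)]) (use ab z1(2) z2(2) in simp_all)
    then show "a = b"
      by (rule regular_epi_cancel[OF z1(1)]) (use ab z1(2) in simp_all)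
  qed
  then show ?thesis
    by (rule that[of m e]) (use m re de D in simp_all)
qed

lemma pullback_of_monic:
  assumes "is_pullback f m n w" "monic m"
  shows "monic n"
proof (rule monicI)
  note D = pullbackD[OF assms(1)]
  show "n \<in> Arr C" by (rule D)
  fix Z u v assume uv: "u \<in> hom C Z (Dom C n)" "v \<in> hom C Z (Dom C n)" "n \<cdot> u = n \<cdot> v"
  show "u = v"
  proof (rule pullback_joint_monic[OF assms(1) uv])
    have "m \<cdot> w \<cdot> u = (f \<cdot> n) \<cdot> u" by (rule reassoc) (use D uv in simp_all)
    also have "\<dots> = f \<cdot> n \<cdot> u" by (rule comp_assoc) (use D uv in simp_all)
    also have "\<dots> = f \<cdot> n \<cdot> v" unfolding uv(3) ..
    also have "\<dots> = (f \<cdot> n) \<cdot> v" by (rule comp_assoc[symmetric]) (use D uv in simp_all)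
    also have "\<dots> = (m \<cdot> w) \<cdot> v" unfolding D(9) ..
    also have "\<dots> = m \<cdot> w \<cdot> v" by (rule comp_assoc) (use D uv in simp_all)
    finally show "w \<cdot> u = w \<cdot> v"
      by (rule monicD[OF assms(2)]) (use D uv in simp_all)
  qed
qed

section \<open>Protomodularity: kernel and section generate a point\<close>

text \<open>
  Change of base along \<open>0 \<rightarrow> B\<close> sends a point over \<open>B\<close> to its kernel. In this form kernels enter
  into protomodularity.
\<close>

lemma kernel_is_pullback:
  assumes "is_kernel p k" "is_zero_object Z"
  shows "is_pullback (zero Z (Cod C p)) p (zero (Dom C k) Z) k"
  unfolding is_pullback_def
proof (intro conjI exI allI ballI impI)
  note K = kernelD[OF assms(1)]
  have Z: "Z \<in> Obj C" using assms(2) unfolding is_zero_object_def is_initial_def by blast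
  show "zero Z (Cod C p) \<in> Arr C" "p \<in> Arr C" "Cod C (zero Z (Cod C p)) = Cod C p"
    "zero (Dom C k) Z \<in> hom C (Dom C k) (Dom C (zero Z (Cod C p)))" "k \<in> hom C (Dom C k) (Dom C p)"
    "zero Z (Cod C p) \<cdot> zero (Dom C k) Z = p \<cdot> k"
    using K Z by simp_all
  fix W a b
  assume a: "a \<in> hom C W (Dom C (zero Z (Cod C p)))" and b: "b \<in> hom C W (Dom C p)"
    and eq: "zero Z (Cod C p) \<cdot> a = p \<cdot> b"
  have a': "a \<in> hom C W Z" using a Z K by simp
  have "p \<cdot> b = zero W (Cod C p)" unfolding eq[symmetric] using a' K by simp
  from kernel_unique_factor[OF assms(1) b this]
  obtain u where u: "u \<in> hom C W (Dom C k) \<and> k \<cdot> u = b"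
    and uniq: "\<And>v. v \<in> hom C W (Dom C k) \<and> k \<cdot> v = b \<Longrightarrow> v = u" by (rule ex1E) blast
  have "zero (Dom C k) Z \<cdot> u = a"
    by (rule to_zero_object_unique[OF assms(2) _ a']) (use u K Z hom_objs(1)[OF b] in simp_all)
  with u uniq show "\<exists>!u. u \<in> hom C W (Dom C k) \<and> zero (Dom C k) Z \<cdot> u = a \<and> k \<cdot> u = b"
    by blast
qed

text \<open>
  A subobject of \<open>A\<close> that contains the kernel and the section of a point is itself a point
  \<open>(p \<cdot> m, s')\<close> over \<open>B\<close>, with the same kernel. So \<open>m\<close> is a morphism of points that restricts to the
  identity of the kernels, and protomodularity makes it invertible.
\<close>

lemma point_generated:
  assumes p: "p \<in> hom C A B" and s: "s \<in> hom C B A" and ps: "p \<cdot> s = Ident C B"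
    and k: "is_kernel p k" and m: "monic m" "Cod C m = A"
    and s': "s' \<in> hom C B (Dom C m)" "m \<cdot> s' = s"
    and k': "k' \<in> hom C (Dom C k) (Dom C m)" "m \<cdot> k' = k"
  shows "iso m"
proof -
  obtain Z where Z: "is_zero_object Z" "Z \<in> Obj C" by (rule zero_object_exists)
  note K = kernelD[OF k]
  have mA: "m \<in> Arr C" using m(1) by (rule monic_arr)
  have B: "B \<in> Obj C" using p by auto
  have pm: "is_kernel (p \<cdot> m) k'"
  proof (rule kernelI)
    show "p \<cdot> m \<in> hom C (Dom C m) B" "k' \<in> hom C (Dom C k) (Dom C m)" using p mA m k' by simp_all
    show "(p \<cdot> m) \<cdot> k' = zero (Dom C k) B" using p mA m k' K by simp
    show "monic k'"
    proof (rule monicI)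
      show "k' \<in> Arr C" using k' by simp
      fix W u v assume uv: "u \<in> hom C W (Dom C k')" "v \<in> hom C W (Dom C k')" "k' \<cdot> u = k' \<cdot> v"
      have "k \<cdot> u = m \<cdot> k' \<cdot> u" by (rule reassoc[OF k'(2), symmetric]) (use uv k' mA in simp_all)
      also have "\<dots> = k \<cdot> v" unfolding uv(3) by (rule reassoc[OF k'(2)]) (use uv k' mA in simp_all)
      finally show "u = v" by (rule monicD[OF kernel_monic[OF k]]) (use uv k' in simp_all)
    qed
    fix W h assume h: "h \<in> hom C W (Dom C m)" "(p \<cdot> m) \<cdot> h = zero W B"
    obtain u where u: "u \<in> hom C W (Dom C k)" "k \<cdot> u = m \<cdot> h"
      by (rule kernel_factor[OF k, of "m \<cdot> h" W]) (use h m mA p in simp_all)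
    have "m \<cdot> k' \<cdot> u = m \<cdot> h" unfolding u(2)[symmetric]
      by (rule reassoc[OF k'(2)]) (use u k' mA in simp_all)
    then have "k' \<cdot> u = h"
      by (rule monicD[OF m(1)]) (use u k' h in simp_all)
    with u show "\<exists>u. u \<in> hom C W (Dom C k) \<and> k' \<cdot> u = h" by blast
  qed
  have pms: "(p \<cdot> m) \<cdot> s' = Ident C B" using p mA m s' ps by simp
  have iK: "iso (Ident C (Dom C k))"
    unfolding iso_def using K by (intro conjI bexI[of _ "Ident C (Dom C k)"]) simp_all
  have pb: "is_pullback (zero Z B) p (zero (Dom C k) Z) k"
    "is_pullback (zero Z B) (p \<cdot> m) (zero (Dom C k') Z) k'"
    using kernel_is_pullback[OF k Z(1)] kernel_is_pullback[OF pm Z(1)] p mA m by simp_all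
  have pt: "is_point B p s" "is_point B (p \<cdot> m) s'" unfolding is_point_def
    using p s ps s' pms mA m by auto
  have ph: "point_hom (p \<cdot> m) s' p s m" unfolding point_hom_def using p mA m s' by simp
  have z: "zero Z B \<in> hom C Z B" using Z B by simp
  have u: "Ident C (Dom C k) \<in> hom C (Dom C (zero (Dom C k') Z)) (Dom C (zero (Dom C k) Z))"
    "zero (Dom C k) Z \<cdot> Ident C (Dom C k) = zero (Dom C k') Z"
    "k \<cdot> Ident C (Dom C k) = m \<cdot> k'"
    using k' K Z by simp_all
  show ?thesis
    using protomodular[unfolded protomodular_def, rule_format, OF conjI, OF z conjI, OF pt(2) conjI,
        OF pt(1) conjI, OF ph conjI, OF pb(2) conjI, OF pb(1) conjI, OF u(1) conjI, OF u(2) conjI,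
        OF u(3) iK] .
qed

text \<open>
  Apply \<open>point_generated\<close> to the inverse image of \<open>m\<close> along \<open>f\<close>. In terms of elements: to show that
  \<open>f\<close> takes its values in a subobject it suffices to test it on the kernel and on the section.
\<close>

lemma point_factor:
  assumes p: "p \<in> hom C A B" and s: "s \<in> hom C B A" and ps: "p \<cdot> s = Ident C B"
    and k: "is_kernel p k" and f: "f \<in> hom C A Y" and m: "monic m" "Cod C m = Y"
    and u: "u \<in> hom C (Dom C k) (Dom C m)" "m \<cdot> u = f \<cdot> k"
    and v: "v \<in> hom C B (Dom C m)" "m \<cdot> v = f \<cdot> s"
  obtains w where "w \<in> hom C A (Dom C m)" "m \<cdot> w = f"
proof -
  note K = kernelD[OF k]
  have mA: "m \<in> Arr C" using m(1) by (rule monic_arr)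
  obtain n w where pb: "is_pullback f m n w"
    by (rule pullback_exists[of f m]) (use f m mA in simp_all)
  note D = pullbackD[OF pb]
  obtain k' where k': "k' \<in> hom C (Dom C k) (Dom C n)" "n \<cdot> k' = k"
    by (rule pullback_factor[OF pb, of k "Dom C k" u]) (use u f p K in simp_all)
  obtain s' where s': "s' \<in> hom C B (Dom C n)" "n \<cdot> s' = s"
    by (rule pullback_factor[OF pb, of s B v]) (use v f p s in simp_all)
  have "iso n"
    by (rule point_generated[OF p s ps k pullback_of_monic[OF pb m(1)] _ s' k']) (use D f in simp)
  then obtain j where j: "j \<in> hom C (Cod C n) (Dom C n)" "n \<cdot> j = Ident C (Cod C n)"
    by (rule isoE)
  have "m \<cdot> w \<cdot> j = (f \<cdot> n) \<cdot> j"
    by (rule reassoc) (use D j in simp_all)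
  also have "\<dots> = f \<cdot> n \<cdot> j" by (rule comp_assoc) (use D j in simp_all)
  also have "\<dots> = f" unfolding j(2) using D f by simp
  finally show ?thesis by (rule that[rotated]) (use D j f in simp_all)
qed

lemma diagonal_monic:
  assumes "Y \<in> Obj C"
  shows "monic (pair (Ident C Y) (Ident C Y))"
proof (rule monicI)
  show "pair (Ident C Y) (Ident C Y) \<in> Arr C" using assms by simp
  fix Z f g
  assume fg: "f \<in> hom C Z (Dom C (pair (Ident C Y) (Ident C Y)))"
    "g \<in> hom C Z (Dom C (pair (Ident C Y) (Ident C Y)))"
    "pair (Ident C Y) (Ident C Y) \<cdot> f = pair (Ident C Y) (Ident C Y) \<cdot> g"
  have "pr1 Y Y \<cdot> pair (Ident C Y) (Ident C Y) \<cdot> f = pr1 Y Y \<cdot> pair (Ident C Y) (Ident C Y) \<cdot> g"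
    unfolding fg(3) ..
  then show "f = g" using fg(1,2) assms by simp
qed

text \<open>
  Two arrows agree where their pairing takes its values in the diagonal.
\<close>

lemma point_joint_epi:
  assumes p: "p \<in> hom C A B" and s: "s \<in> hom C B A" and ps: "p \<cdot> s = Ident C B"
    and k: "is_kernel p k" and fg: "f \<in> hom C A Y" "g \<in> hom C A Y"
    and eq: "f \<cdot> k = g \<cdot> k" "f \<cdot> s = g \<cdot> s"
  shows "f = g"
proof -
  note K = kernelD[OF k]
  have Y: "Y \<in> Obj C" using fg by auto
  let ?d = "pair (Ident C Y) (Ident C Y)"
  obtain w where w: "w \<in> hom C A (Dom C ?d)" "?d \<cdot> w = pair f g"
  proof (rule point_factor[OF p s ps k, of "pair f g" "prod Y Y" ?d "f \<cdot> k" "f \<cdot> s"])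
    show "?d \<cdot> f \<cdot> k = pair f g \<cdot> k"
      using fg K p eq Y by (simp add: pair_comp)
    show "?d \<cdot> f \<cdot> s = pair f g \<cdot> s"
      using fg s p eq Y by (simp add: pair_comp)
  qed (use fg Y K s p diagonal_monic in simp_all)
  have "f = pr1 Y Y \<cdot> pair f g" "g = pr2 Y Y \<cdot> pair f g" using fg by simp_all
  then show ?thesis unfolding w(2)[symmetric] using w(1) Y by simp
qed

lemma product_kernel:
  assumes "X \<in> Obj C" "Y \<in> Obj C"
  shows "is_kernel (pr2 X Y) (pair (Ident C X) (zero X Y))"
proof (rule kernelI)
  let ?k = "pair (Ident C X) (zero X Y)"
  show "pr2 X Y \<in> hom C (prod X Y) Y" "?k \<in> hom C X (prod X Y)" "pr2 X Y \<cdot> ?k = zero X Y"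
    using assms by simp_all
  show "monic ?k"
  proof (rule monicI)
    fix Z u v assume uv: "u \<in> hom C Z (Dom C ?k)" "v \<in> hom C Z (Dom C ?k)" "?k \<cdot> u = ?k \<cdot> v"
    have "pr1 X Y \<cdot> ?k \<cdot> u = pr1 X Y \<cdot> ?k \<cdot> v" unfolding uv(3) ..
    then show "u = v" using uv(1,2) assms by simp
  qed (use assms in simp)
  fix Z h assume h: "h \<in> hom C Z (prod X Y)" "pr2 X Y \<cdot> h = zero Z Y"
  have "Z \<in> Obj C" using h by auto
  have "?k \<cdot> pr1 X Y \<cdot> h = h"
    by (rule prod_eqI[where Z = Z and A = X and B = Y]) (use h assms in simp_all)
  then show "\<exists>u. u \<in> hom C Z X \<and> ?k \<cdot> u = h"
    using h assms by (intro exI[of _ "pr1 X Y \<cdot> h"]) simp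
qed

lemma product_point:
  assumes "X \<in> Obj C" "Y \<in> Obj C"
  shows "pr2 X Y \<in> hom C (prod X Y) Y" "pair (zero Y X) (Ident C Y) \<in> hom C Y (prod X Y)"
    "pr2 X Y \<cdot> pair (zero Y X) (Ident C Y) = Ident C Y"
  using assms by simp_all

lemma regular_epiI:
  assumes "f \<in> Arr C"
    and "\<And>m e. \<lbrakk>monic m; m \<in> hom C (Dom C m) (Cod C f); e \<in> hom C (Dom C f) (Dom C m);
      m \<cdot> e = f\<rbrakk> \<Longrightarrow> iso m"
  shows "regular_epi f"
proof -
  obtain m e where me: "monic m" "m \<in> hom C (Dom C m) (Cod C f)" "regular_epi e"
    "e \<in> hom C (Dom C f) (Dom C m)" "m \<cdot> e = f" by (rule image_exists[OF assms(1)])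
  have "iso m" by (rule assms(2)[OF me(1,2,4,5)])
  have "regular_epi (m \<cdot> e)" by (rule regular_epi_iso_comp[OF me(3) \<open>iso m\<close>]) (use me in simp)
  then show ?thesis using me by simp
qed

text \<open>
  The first projection \<open>p\<close> of the kernel pair of \<open>f\<close> is split by the diagonal \<open>d\<close>, and on the kernel
  of \<open>p\<close> the second projection \<open>q\<close> takes its values in the kernel of \<open>f\<close>. Hence, if \<open>h\<close> vanishes on
  the kernel of \<open>f\<close>, the arrows \<open>h \<cdot> p\<close> and \<open>h \<cdot> q\<close> agree on the kernel and on the section of the
  point \<open>(p, d)\<close>; so they are equal, and \<open>h\<close> descends along \<open>f\<close>.
\<close>

lemma regular_epi_coker:
  assumes f: "regular_epi f" and k: "is_kernel f k"
  shows "is_cokernel k f"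
proof -
  note K = kernelD[OF k]
  obtain f1 f2 where ce: "is_coequalizer f1 f2 f" using f unfolding regular_epi_def by blast
  note E = coequalizerD[OF ce]
  obtain p q where pb: "is_pullback f f p q" by (rule pullback_exists[OF K(1) K(1) refl])
  note D = pullbackD[OF pb]
  obtain d where d: "d \<in> hom C (Dom C f) (Dom C p)" "p \<cdot> d = Ident C (Dom C f)"
    "q \<cdot> d = Ident C (Dom C f)"
    by (rule pullback_factor[OF pb, of "Ident C (Dom C f)" "Dom C f" "Ident C (Dom C f)"])
      (use K in simp_all)
  obtain g where g: "g \<in> hom C (Dom C f1) (Dom C p)" "p \<cdot> g = f1" "q \<cdot> g = f2"
    by (rule pullback_factor[OF pb, of f1 "Dom C f1" f2]) (use E in simp_all)
  obtain j where j: "is_kernel p j" using kernel_exists[OF D(4)] ..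
  note J = kernelD[OF j]
  have "f \<cdot> q \<cdot> j = (f \<cdot> p) \<cdot> j" by (rule reassoc) (use D J in simp_all)
  also have "\<dots> = zero (Dom C j) (Cod C f)" using D(1,4,7) J by simp
  finally obtain w where w: "w \<in> hom C (Dom C j) (Dom C k)" "k \<cdot> w = q \<cdot> j"
    by (rule kernel_factor[OF k, of "q \<cdot> j" "Dom C j", rotated 1]) (use D J in simp_all)
  have main: "\<exists>u. u \<in> hom C (Cod C f) Z \<and> u \<cdot> f = h"
    if h: "h \<in> hom C (Dom C f) Z" "h \<cdot> k = zero (Dom C k) Z" for Z h
  proof -
    have Z: "Z \<in> Obj C" using h by auto
    have "h \<cdot> k \<cdot> w = zero (Dom C k) Z \<cdot> w"
      by (rule reassoc[OF h(2)]) (use h K w in simp_all)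
    then have hj: "h \<cdot> q \<cdot> j = zero (Dom C j) Z" unfolding w(2) using w Z by simp
    have "h \<cdot> p = h \<cdot> q"
    proof (rule point_joint_epi[OF _ d(1,2) j, of "h \<cdot> p" Z "h \<cdot> q"])
      show "(h \<cdot> p) \<cdot> j = (h \<cdot> q) \<cdot> j" using h(1) D(4-8) J hj by simp
      show "(h \<cdot> p) \<cdot> d = (h \<cdot> q) \<cdot> d" using h(1) D(4-8) d by simp
    qed (use h D(4-8) in simp_all)
    then have "(h \<cdot> p) \<cdot> g = (h \<cdot> q) \<cdot> g" by simp
    then have "h \<cdot> f1 = h \<cdot> f2" using h(1) D(4-8) g by simp
    then obtain u where "u \<in> hom C (Cod C f) Z" "u \<cdot> f = h"
      by (rule coequalizer_factor[OF ce, of h Z, rotated 1]) (use h in simp_all)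
    then show ?thesis by blast
  qed
  have "\<exists>!u. u \<in> hom C (Cod C f) Z \<and> u \<cdot> f = h"
    if h: "h \<in> hom C (Dom C f) Z" "h \<cdot> k = zero (Dom C k) Z" for Z h
    using main[OF h]
  proof (rule ex_ex1I)
    fix u v assume uv: "u \<in> hom C (Cod C f) Z \<and> u \<cdot> f = h" "v \<in> hom C (Cod C f) Z \<and> v \<cdot> f = h"
    show "u = v" by (rule regular_epi_cancel[OF f]) (use uv in simp_all)
  qed
  then have "\<forall>Z. \<forall>h \<in> hom C (Dom C f) Z. h \<cdot> k = zero (Dom C k) Z \<longrightarrow>
      (\<exists>!u. u \<in> hom C (Cod C f) Z \<and> u \<cdot> f = h)" by (intro allI ballI impI)
  moreover have "k \<in> hom C (Dom C k) (Dom C f)" "f \<in> hom C (Dom C f) (Cod C f)" using K by simp_all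
  ultimately show ?thesis unfolding is_cokernel_def using K(4)
    by (intro exI[of _ "Dom C k"] exI[of _ "Dom C f"] exI[of _ "Cod C f"] conjI)
qed

lemma product_generated:
  assumes "X \<in> Obj C" "Y \<in> Obj C" "monic m" "Cod C m = prod X Y"
    and "u \<in> hom C X (Dom C m)" "m \<cdot> u = pair (Ident C X) (zero X Y)"
    and "v \<in> hom C Y (Dom C m)" "m \<cdot> v = pair (zero Y X) (Ident C Y)"
  shows "iso m"
proof (rule point_generated[OF product_point[OF assms(1,2)] product_kernel[OF assms(1,2)]
      assms(3,4,7,8) _ assms(6)])
  show "u \<in> hom C (Dom C (pair (Ident C X) (zero X Y))) (Dom C m)" using assms(1,2,5) by simp
qed

lemma product_joint_epi:
  assumes "X \<in> Obj C" "Y \<in> Obj C" "f \<in> hom C (prod X Y) Z" "g \<in> hom C (prod X Y) Z"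
    and "f \<cdot> pair (Ident C X) (zero X Y) = g \<cdot> pair (Ident C X) (zero X Y)"
    and "f \<cdot> pair (zero Y X) (Ident C Y) = g \<cdot> pair (zero Y X) (Ident C Y)"
  shows "f = g"
  by (rule point_joint_epi[OF product_point[OF assms(1,2)] product_kernel[OF assms(1,2)] assms(3-6)])

lemma coprod_to_prod_typing [simp]:
  assumes "X \<in> Obj C" "Y \<in> Obj C"
  shows "coprod_to_prod X Y \<in> Arr C" "Dom C (coprod_to_prod X Y) = coprod X Y"
    "Cod C (coprod_to_prod X Y) = prod X Y"
    "coprod_to_prod X Y \<cdot> inj1 X Y = pair (Ident C X) (zero X Y)"
    "coprod_to_prod X Y \<cdot> inj2 X Y = pair (zero Y X) (Ident C Y)"
  using assms unfolding coprod_to_prod_def by simp_all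

text \<open>
  Its image contains both axes of the product, and these generate it.
\<close>

lemma coprod_to_prod_regular_epi:
  assumes "X \<in> Obj C" "Y \<in> Obj C"
  shows "regular_epi (coprod_to_prod X Y)"
proof (rule regular_epiI)
  show "coprod_to_prod X Y \<in> Arr C" using assms by simp
  fix m e
  assume m: "monic m" "m \<in> hom C (Dom C m) (Cod C (coprod_to_prod X Y))"
    and e: "e \<in> hom C (Dom C (coprod_to_prod X Y)) (Dom C m)" and me: "m \<cdot> e = coprod_to_prod X Y"
  show "iso m"
  proof (rule product_generated[OF assms m(1), of "e \<cdot> inj1 X Y" "e \<cdot> inj2 X Y"])
    have "m \<cdot> e \<cdot> inj1 X Y = coprod_to_prod X Y \<cdot> inj1 X Y"
      by (rule reassoc[OF me]) (use m e assms in simp_all)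
    then show "m \<cdot> e \<cdot> inj1 X Y = pair (Ident C X) (zero X Y)" using assms by simp
    have "m \<cdot> e \<cdot> inj2 X Y = coprod_to_prod X Y \<cdot> inj2 X Y"
      by (rule reassoc[OF me]) (use m e assms in simp_all)
    then show "m \<cdot> e \<cdot> inj2 X Y = pair (zero Y X) (Ident C Y)" using assms by simp
  qed (use m e assms in simp_all)
qed

text \<open>
  The arrow is \<open>q \<times> q\<close>. Its image contains the images under \<open>q\<close> of the axes of \<open>X \<times> X\<close>; as \<open>q\<close> is
  a strong epimorphism, it contains the axes of \<open>Q \<times> Q\<close>.
\<close>

lemma square_regular_epi:
  assumes q: "regular_epi q" "q \<in> hom C X Q"
  shows "regular_epi (pair (q \<cdot> pr1 X X) (q \<cdot> pr2 X X))" (is "regular_epi ?qq")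
proof (rule regular_epiI)
  have obj: "X \<in> Obj C" "Q \<in> Obj C" using q by auto
  have qq: "?qq \<in> Arr C" "Dom C ?qq = prod X X" "Cod C ?qq = prod Q Q" using q obj by simp_all
  show "?qq \<in> Arr C" by (rule qq)
  fix m e
  assume m: "monic m" "m \<in> hom C (Dom C m) (Cod C ?qq)"
    and e: "e \<in> hom C (Dom C ?qq) (Dom C m)" and me: "m \<cdot> e = ?qq"
  have mty: "m \<in> hom C (Dom C m) (prod Q Q)" "e \<in> hom C (prod X X) (Dom C m)" using m e qq by simp_all
  let ?x1 = "pair (Ident C X) (zero X X)" and ?x2 = "pair (zero X X) (Ident C X)"
    and ?q1 = "pair (Ident C Q) (zero Q Q)" and ?q2 = "pair (zero Q Q) (Ident C Q)"
  have "m \<cdot> e \<cdot> ?x1 = ?qq \<cdot> ?x1" "m \<cdot> e \<cdot> ?x2 = ?qq \<cdot> ?x2"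
    by (rule reassoc[OF me], use mty obj in simp_all)+
  moreover have "?qq \<cdot> ?x1 = ?q1 \<cdot> q" "?qq \<cdot> ?x2 = ?q2 \<cdot> q"
    using q(2) obj by (simp_all add: pair_comp)
  ultimately have eq: "m \<cdot> e \<cdot> ?x1 = ?q1 \<cdot> q" "m \<cdot> e \<cdot> ?x2 = ?q2 \<cdot> q" by simp_all
  obtain u where u: "u \<in> hom C Q (Dom C m)" "m \<cdot> u = ?q1"
    by (rule regular_epi_diagonal[OF q(1) m(1) eq(1)]) (use q(2) obj mty in simp_all)
  obtain v where v: "v \<in> hom C Q (Dom C m)" "m \<cdot> v = ?q2"
    by (rule regular_epi_diagonal[OF q(1) m(1) eq(2)]) (use q(2) obj mty in simp_all)
  show "iso m"
    by (rule product_generated[OF obj(2) obj(2) m(1) _ u v]) (use mty in simp)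
qed

section \<open>Normal subobjects and their quotients\<close>

lemma cokernelD:
  assumes "is_cokernel n q"
  shows "n \<in> Arr C" "q \<in> Arr C" "Cod C n = Dom C q" "q \<cdot> n = zero (Dom C n) (Cod C q)"
  using assms unfolding is_cokernel_def by auto

lemma cokernel_unique_factor:
  assumes "is_cokernel n q" "h \<in> hom C (Dom C q) Z" "h \<cdot> n = zero (Dom C n) Z"
  shows "\<exists>!u. u \<in> hom C (Cod C q) Z \<and> u \<cdot> q = h"
proof -
  obtain A B Q where K: "n \<in> hom C A B" "q \<in> hom C B Q"
    "\<forall>Z. \<forall>h \<in> hom C B Z. h \<cdot> n = zero A Z \<longrightarrow> (\<exists>!u. u \<in> hom C Q Z \<and> u \<cdot> q = h)"
    using assms(1) unfolding is_cokernel_def by blast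
  then have "A = Dom C n" "B = Dom C q" "Q = Cod C q" by auto
  with K(3) assms(2,3) show ?thesis by blast
qed

lemma cokernel_factor:
  assumes "is_cokernel n q" "h \<in> hom C (Dom C q) Z" "h \<cdot> n = zero (Dom C n) Z"
  obtains u where "u \<in> hom C (Cod C q) Z" "u \<cdot> q = h"
  using cokernel_unique_factor[OF assms] by blast

lemma cokernel_regular_epi:
  assumes "is_cokernel n q"
  shows "regular_epi q"
proof -
  note D = cokernelD[OF assms]
  let ?z = "zero (Dom C n) (Dom C q)"
  have univ: "\<exists>!u. u \<in> hom C (Cod C q) Z \<and> u \<cdot> q = h"
    if h: "h \<in> hom C (Dom C q) Z" "h \<cdot> n = h \<cdot> ?z" for Z h
    by (rule cokernel_unique_factor[OF assms h(1)]) (use h D in simp)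
  have "n \<in> hom C (Dom C n) (Dom C q)" "?z \<in> hom C (Dom C n) (Dom C q)"
    "q \<in> hom C (Dom C q) (Cod C q)" "q \<cdot> n = q \<cdot> ?z" using D by simp_all
  moreover from univ have "\<forall>Z. \<forall>h \<in> hom C (Dom C q) Z. h \<cdot> n = h \<cdot> ?z \<longrightarrow>
      (\<exists>!u. u \<in> hom C (Cod C q) Z \<and> u \<cdot> q = h)" by (intro allI ballI impI)
  ultimately have "is_coequalizer n ?z q" unfolding is_coequalizer_def
    by (intro exI[of _ "Dom C n"] exI[of _ "Dom C q"] exI[of _ "Cod C q"] conjI)
  then show ?thesis unfolding regular_epi_def by blast
qed

lemma normal_monic:
  assumes "normal n"
  shows "monic n" "n \<in> Arr C"
  using assms kernel_monic monic_arr unfolding normal_def by blast+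

text \<open>
  If \<open>n\<close> is a kernel of \<open>f = m \<cdot> e\<close> with \<open>m\<close> monic, it is a kernel of the regular epimorphism \<open>e\<close>,
  and then \<open>e\<close> is its cokernel.
\<close>

lemma normal_cokernel_exists:
  assumes "normal n"
  obtains q where "is_cokernel n q"
proof -
  obtain f where f: "is_kernel f n" using assms unfolding normal_def by blast
  note K = kernelD[OF f]
  obtain m e where m: "monic m" "m \<in> hom C (Dom C m) (Cod C f)" "regular_epi e"
    "e \<in> hom C (Dom C f) (Dom C m)" "m \<cdot> e = f" by (rule image_exists[OF K(1)])
  have "is_kernel e n"
  proof (rule kernelI[OF m(4) kernel_monic[OF f]])
    show "n \<in> hom C (Dom C n) (Dom C f)" using K by simp
    have "m \<cdot> e \<cdot> n = f \<cdot> n" by (rule reassoc[OF m(5)]) (use m K in simp_all)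
    also have "\<dots> = m \<cdot> zero (Dom C n) (Dom C m)" using K m(2) by simp
    finally show "e \<cdot> n = zero (Dom C n) (Dom C m)"
      by (rule monicD[OF m(1)]) (use m(2,4) K in simp_all)
    fix Z h assume h: "h \<in> hom C Z (Dom C f)" "e \<cdot> h = zero Z (Dom C m)"
    have "f \<cdot> h = m \<cdot> e \<cdot> h" by (rule reassoc[OF m(5), symmetric]) (use m h in simp_all)
    also have "\<dots> = zero Z (Cod C f)" unfolding h(2) using m(2) h(1) by auto
    finally show "\<exists>u. u \<in> hom C Z (Dom C n) \<and> n \<cdot> u = h"
      using kernel_factor[OF f h(1)] by blast
  qed
  from that[OF regular_epi_coker[OF m(3) this]] show ?thesis .
qed

lemma normal_kernel_of_cokernel:
  assumes "normal n" "is_cokernel n q"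
  shows "is_kernel q n"
proof (rule kernelI[OF _ normal_monic(1)[OF assms(1)]])
  note D = cokernelD[OF assms(2)]
  obtain f where f: "is_kernel f n" using assms unfolding normal_def by blast
  note K = kernelD[OF f]
  show "q \<in> hom C (Dom C q) (Cod C q)" "n \<in> hom C (Dom C n) (Dom C q)"
    "q \<cdot> n = zero (Dom C n) (Cod C q)" using D by simp_all
  obtain u where u: "u \<in> hom C (Cod C q) (Cod C f)" "u \<cdot> q = f"
    by (rule cokernel_factor[OF assms(2), of f "Cod C f"]) (use K D in simp_all)
  fix Z h assume h: "h \<in> hom C Z (Dom C q)" "q \<cdot> h = zero Z (Cod C q)"
  have "f \<cdot> h = u \<cdot> q \<cdot> h" by (rule reassoc[OF u(2), symmetric]) (use u h D in simp_all)
  also have "\<dots> = zero Z (Cod C f)" unfolding h(2) using u(1) h(1) by auto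
  finally have fh: "f \<cdot> h = zero Z (Cod C f)" .
  have "h \<in> hom C Z (Dom C f)" using h K D by simp
  from kernel_factor[OF f this fh] show "\<exists>u. u \<in> hom C Z (Dom C n) \<and> n \<cdot> u = h" by blast
qed

section \<open>Reflexive relations are effective equivalence relations\<close>

text \<open>
  In terms of elements: if \<open>(u, v)\<close>, \<open>(u', v)\<close> and \<open>(u', v')\<close> belong to the relation \<open>R\<close>, then so
  does \<open>(u, v')\<close>. Let \<open>W\<close> consist of all such triples of members of \<open>R\<close>, and \<open>B\<close> of the pairs of
  their last two members. The projection \<open>w2\<close> from \<open>W\<close> to \<open>B\<close> is split by repeating \<open>(u', v)\<close>; on
  this section \<open>(u, v')\<close> is the member \<open>(u', v')\<close>. On the kernel of \<open>w2\<close> one has \<open>u' = v = v' = 0\<close>, and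
  \<open>(u, v')\<close> is the member \<open>(u, v)\<close>. By \<open>point_factor\<close> this is enough.
\<close>

lemma difunctional:
  assumes r: "r \<in> hom C R X" and s: "s \<in> hom C R X"
    and mono: "monic (pair r s)"
    and abc: "a \<in> hom C Z R" "b \<in> hom C Z R" "c \<in> hom C Z R"
    and eq: "s \<cdot> a = s \<cdot> b" "r \<cdot> b = r \<cdot> c"
  obtains d where "d \<in> hom C Z R" "r \<cdot> d = r \<cdot> a" "s \<cdot> d = s \<cdot> c"
proof -
  obtain b1 b2 where pb: "is_pullback r r b1 b2" by (rule pullback_exists[of r r]) (use r in simp_all)
  note P = pullbackD[OF pb]
  let ?B = "Dom C b1"
  have b12: "b1 \<in> hom C ?B R" "b2 \<in> hom C ?B R" using P r by simp_all
  obtain w1 w2 where pw: "is_pullback s (s \<cdot> b1) w1 w2"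
    by (rule pullback_exists[of s "s \<cdot> b1"]) (use s b12 in simp_all)
  note W = pullbackD[OF pw]
  let ?W = "Dom C w1"
  have w12: "w1 \<in> hom C ?W R" "w2 \<in> hom C ?W ?B" using W s b12 by simp_all
  have sw: "s \<cdot> w1 = s \<cdot> b1 \<cdot> w2" unfolding W(9) using s b12 w12 by simp
  obtain t where t: "t \<in> hom C ?B ?W" "w1 \<cdot> t = b1" "w2 \<cdot> t = Ident C ?B"
    by (rule pullback_factor[OF pw, of b1 ?B "Ident C ?B"]) (use s b12 in simp_all)
  obtain k where k: "is_kernel w2 k" using kernel_exists[OF W(5)] ..
  note K = kernelD[OF k]
  have kt: "k \<in> hom C (Dom C k) ?W" "w2 \<cdot> k = zero (Dom C k) ?B" using K w12 by simp_all
  have "s \<cdot> w1 \<cdot> k = (s \<cdot> b1 \<cdot> w2) \<cdot> k" by (rule reassoc[OF sw]) (use s w12 kt in simp_all)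
  also have "\<dots> = zero (Dom C k) X" using s b12 w12 kt by simp
  finally have swk: "s \<cdot> w1 \<cdot> k = zero (Dom C k) X" .
  let ?f = "pair (r \<cdot> w1) (s \<cdot> b2 \<cdot> w2)"
  obtain w where w: "w \<in> hom C ?W (Dom C (pair r s))" "pair r s \<cdot> w = ?f"
  proof (rule point_factor[OF w12(2) t(1,3) k, of ?f "prod X X" "pair r s" "w1 \<cdot> k" b2])
    show "pair r s \<cdot> w1 \<cdot> k = ?f \<cdot> k"
      using r s b12 w12 kt swk by (simp add: pair_comp)
    show "pair r s \<cdot> b2 = ?f \<cdot> t"
      using r s b12 w12 t P(9) by (simp add: pair_comp)
  qed (use r s b12 w12 kt mono in simp_all)
  have wR: "w \<in> hom C ?W R" using w r s by simp
  have "r \<cdot> w = pr1 X X \<cdot> pair r s \<cdot> w" "s \<cdot> w = pr2 X X \<cdot> pair r s \<cdot> w"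
    using r s wR by simp_all
  then have rw: "r \<cdot> w = r \<cdot> w1" "s \<cdot> w = s \<cdot> b2 \<cdot> w2"
    unfolding w(2) using r s b12 w12 by simp_all
  obtain \<beta> where \<beta>: "\<beta> \<in> hom C Z ?B" "b1 \<cdot> \<beta> = b" "b2 \<cdot> \<beta> = c"
    by (rule pullback_factor[OF pb, of b Z c]) (use abc r eq in simp_all)
  obtain \<omega> where \<omega>: "\<omega> \<in> hom C Z ?W" "w1 \<cdot> \<omega> = a" "w2 \<cdot> \<omega> = \<beta>"
    by (rule pullback_factor[OF pw, of a Z \<beta>]) (use abc s b12 \<beta> eq in simp_all)
  have "r \<cdot> w \<cdot> \<omega> = (r \<cdot> w1) \<cdot> \<omega>" by (rule reassoc[OF rw(1)]) (use r wR \<omega> in simp_all)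
  moreover have "s \<cdot> w \<cdot> \<omega> = (s \<cdot> b2 \<cdot> w2) \<cdot> \<omega>"
    by (rule reassoc[OF rw(2)]) (use s wR \<omega> in simp_all)
  ultimately have "r \<cdot> w \<cdot> \<omega> = r \<cdot> a" "s \<cdot> w \<cdot> \<omega> = s \<cdot> c"
    using r s b12 w12 \<omega> \<beta> by simp_all
  then show ?thesis by (rule that[rotated]) (use wR \<omega> in simp)
qed

text \<open>
  Difunctionality applied to \<open>(y, y)\<close>, \<open>(x, y)\<close>, \<open>(x, x)\<close> gives \<open>(y, x)\<close>, and applied to \<open>(x, y)\<close>,
  \<open>(y, y)\<close>, \<open>(y, z)\<close> it gives \<open>(x, z)\<close>.
\<close>

lemma reflexive_relation_equivalence:
  assumes r: "r \<in> hom C R X" and s: "s \<in> hom C R X"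
    and mono: "monic (pair r s)"
    and d: "d \<in> hom C X R" "r \<cdot> d = Ident C X" "s \<cdot> d = Ident C X"
  shows "equivalence_relation r s"
  unfolding equivalence_relation_def
proof (rule exI[of _ R], rule exI[of _ X], intro conjI)
  show "r \<in> hom C R X" "s \<in> hom C R X" by fact+
  have "R \<in> Obj C" using r by auto
  note rd = reassoc[OF d(2)] and sd = reassoc[OF d(3)]
  show "\<forall>A. \<forall>f \<in> hom C A R. \<forall>g \<in> hom C A R. r \<cdot> f = r \<cdot> g \<and> s \<cdot> f = s \<cdot> g \<longrightarrow> f = g"
  proof (intro allI ballI impI)
    fix A f g assume fg: "f \<in> hom C A R" "g \<in> hom C A R" "r \<cdot> f = r \<cdot> g \<and> s \<cdot> f = s \<cdot> g"
    have "pair r s \<cdot> f = pair r s \<cdot> g" using fg r s by (simp add: pair_comp)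
    then show "f = g" by (rule monicD[OF mono]) (use fg r s in simp_all)
  qed
  show "\<exists>d \<in> hom C X R. r \<cdot> d = Ident C X \<and> s \<cdot> d = Ident C X" using d by blast
  obtain t where t: "t \<in> hom C R R" "r \<cdot> t = r \<cdot> d \<cdot> s" "s \<cdot> t = s \<cdot> d \<cdot> r"
    by (rule difunctional[OF r s mono, of "d \<cdot> s" R "Ident C R" "d \<cdot> r"])
      (use r s d \<open>R \<in> Obj C\<close> in \<open>simp_all add: rd sd\<close>)
  have "r \<cdot> t = s" "s \<cdot> t = r" using t(2,3) r s d by (simp_all add: rd sd)
  with t(1) show "\<exists>t \<in> hom C R R. r \<cdot> t = s \<and> s \<cdot> t = r" by blast
  show "\<forall>p q. is_pullback s r p q \<longrightarrow> (\<exists>t \<in> hom C (Dom C p) R. r \<cdot> t = r \<cdot> p \<and> s \<cdot> t = s \<cdot> q)"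
  proof (intro allI impI)
    fix p q assume pb: "is_pullback s r p q"
    note P = pullbackD[OF pb]
    have pq: "p \<in> hom C (Dom C p) R" "q \<in> hom C (Dom C p) R" using P r s by simp_all
    have eq: "s \<cdot> p = s \<cdot> d \<cdot> s \<cdot> p" "r \<cdot> d \<cdot> s \<cdot> p = r \<cdot> q"
      using r s d pq P(9) by (simp_all add: rd sd)
    obtain t where "t \<in> hom C (Dom C p) R" "r \<cdot> t = r \<cdot> p" "s \<cdot> t = s \<cdot> q"
      by (rule difunctional[OF r s mono, of p "Dom C p" "d \<cdot> s \<cdot> p" q, OF _ _ _ eq])
        (use pq r s d in simp_all)
    then show "\<exists>t \<in> hom C (Dom C p) R. r \<cdot> t = r \<cdot> p \<and> s \<cdot> t = s \<cdot> q" by blast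
  qed
qed

lemma reflexive_relation_quotient:
  assumes r: "r \<in> hom C R X" and s: "s \<in> hom C R X"
    and mono: "monic (pair r s)"
    and d: "d \<in> hom C X R" "r \<cdot> d = Ident C X" "s \<cdot> d = Ident C X"
  obtains q where "is_coequalizer r s q"
    "\<And>Z a b. \<lbrakk>a \<in> hom C Z X; b \<in> hom C Z X; q \<cdot> a = q \<cdot> b\<rbrakk> \<Longrightarrow>
      \<exists>c. c \<in> hom C Z R \<and> r \<cdot> c = a \<and> s \<cdot> c = b"
proof -
  obtain f where kp: "is_kernel_pair f r s"
    using barr_exact reflexive_relation_equivalence[OF assms] unfolding barr_exact_def by blast
  then have pb: "is_pullback f f r s" unfolding is_kernel_pair_def .
  note P = pullbackD[OF pb]
  obtain q where q: "is_coequalizer r s q" using regular kp unfolding regular_def by blast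
  note Q = coequalizerD[OF q]
  obtain u where u: "u \<in> hom C (Cod C q) (Cod C f)" "u \<cdot> q = f"
    by (rule coequalizer_factor[OF q, of f "Cod C f"]) (use P Q in simp_all)
  show ?thesis
  proof (rule that[OF q])
    fix Z a b assume ab: "a \<in> hom C Z X" "b \<in> hom C Z X" "q \<cdot> a = q \<cdot> b"
    have qX: "Dom C q = X" "Dom C f = X" using Q P r by simp_all
    have "f \<cdot> a = u \<cdot> q \<cdot> a" by (rule reassoc[OF u(2), symmetric]) (use ab u Q qX in simp_all)
    also have "\<dots> = f \<cdot> b" unfolding ab(3) by (rule reassoc[OF u(2)]) (use ab u Q qX in simp_all)
    finally have fab: "f \<cdot> a = f \<cdot> b" .
    obtain c where "c \<in> hom C Z (Dom C r)" "r \<cdot> c = a" "s \<cdot> c = b"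
      by (rule pullback_factor[OF pb _ _ fab, of Z]) (use ab qX in simp_all)
    then show "\<exists>c. c \<in> hom C Z R \<and> r \<cdot> c = a \<and> s \<cdot> c = b" using r by auto
  qed
qed

section \<open>The monad of actions\<close>

lemma is_kernel_flat_ker:
  assumes "B \<in> Obj C" "X \<in> Obj C"
  shows "is_kernel (copair (Ident C B) (zero X B)) (flat_ker B X)"
  unfolding flat_ker_def using assms by (intro is_kernel_ker) simp

lemma flat_ker_typing [simp]:
  assumes "B \<in> Obj C" "X \<in> Obj C"
  shows "flat_ker B X \<in> Arr C" "Dom C (flat_ker B X) = flat B X"
    "Cod C (flat_ker B X) = coprod B X"
    "copair (Ident C B) (zero X B) \<cdot> flat_ker B X = zero (flat B X) B"
  using kernelD[OF is_kernel_flat_ker[OF assms]] assms by (simp_all add: flat_def)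

lemma flat_obj [simp]: "B \<in> Obj C \<Longrightarrow> X \<in> Obj C \<Longrightarrow> flat B X \<in> Obj C"
  using Dom_obj[of "flat_ker B X"] by simp

lemma flat_ker_monic:
  assumes "B \<in> Obj C" "X \<in> Obj C"
  shows "monic (flat_ker B X)"
  by (rule kernel_monic[OF is_kernel_flat_ker[OF assms]])

lemma factor_flat_ker:
  assumes "B \<in> Obj C" "X \<in> Obj C" "h \<in> hom C Z (coprod B X)"
    and "copair (Ident C B) (zero X B) \<cdot> h = zero Z B"
  shows "factor (flat_ker B X) h \<in> hom C Z (flat B X)" "flat_ker B X \<cdot> factor (flat_ker B X) h = h"
proof -
  obtain u where u: "u \<in> hom C Z (Dom C (flat_ker B X))" "flat_ker B X \<cdot> u = h"
    by (rule kernel_factor[OF is_kernel_flat_ker[OF assms(1,2)], of h Z]) (use assms in simp_all)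
  have "u \<in> hom C (Dom C h) (Dom C (flat_ker B X))" using u assms(3) by simp
  from factor_spec[OF flat_ker_monic[OF assms(1,2)] this u(2)]
  show "factor (flat_ker B X) h \<in> hom C Z (flat B X)"
    "flat_ker B X \<cdot> factor (flat_ker B X) h = h" using assms by simp_all
qed

lemma flat_unit:
  assumes "B \<in> Obj C" "X \<in> Obj C"
  shows "flat_unit B X \<in> hom C X (flat B X)" "flat_ker B X \<cdot> flat_unit B X = inj2 B X"
  unfolding flat_unit_def by (rule factor_flat_ker; use assms in simp)+

lemma flat_map:
  assumes "B \<in> Obj C" "f \<in> hom C X Y"
  shows "flat_map B f \<in> hom C (flat B X) (flat B Y)"
    "flat_ker B Y \<cdot> flat_map B f = copair (inj1 B Y) (inj2 B Y \<cdot> f) \<cdot> flat_ker B X"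
proof -
  have obj: "X \<in> Obj C" "Y \<in> Obj C" using assms by auto
  let ?h = "copair (inj1 B Y) (inj2 B Y \<cdot> f) \<cdot> flat_ker B X"
  have h: "?h \<in> hom C (flat B X) (coprod B Y)" using assms obj by simp
  have "copair (Ident C B) (zero Y B) \<cdot> copair (inj1 B Y) (inj2 B Y \<cdot> f) =
      copair (Ident C B) (zero X B)"
    using assms obj by (simp add: comp_copair)
  then have "copair (Ident C B) (zero Y B) \<cdot> ?h = copair (Ident C B) (zero X B) \<cdot> flat_ker B X"
    by (rule reassoc) (use assms obj in simp_all)
  then have z: "copair (Ident C B) (zero Y B) \<cdot> ?h = zero (flat B X) B" using assms(1) obj by simp
  have "flat_map B f = factor (flat_ker B Y) ?h" unfolding flat_map_def using assms by simp
  then show "flat_map B f \<in> hom C (flat B X) (flat B Y)" "flat_ker B Y \<cdot> flat_map B f = ?h"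
    using factor_flat_ker[OF assms(1) obj(2) h z] by simp_all
qed

lemma flat_mult:
  assumes "B \<in> Obj C" "X \<in> Obj C"
  shows "flat_mult B X \<in> hom C (flat B (flat B X)) (flat B X)"
    "flat_ker B X \<cdot> flat_mult B X = copair (inj1 B X) (flat_ker B X) \<cdot> flat_ker B (flat B X)"
proof -
  let ?h = "copair (inj1 B X) (flat_ker B X) \<cdot> flat_ker B (flat B X)"
  have h: "?h \<in> hom C (flat B (flat B X)) (coprod B X)" using assms by simp
  have "copair (Ident C B) (zero X B) \<cdot> copair (inj1 B X) (flat_ker B X) =
      copair (Ident C B) (zero (flat B X) B)"
    using assms by (simp add: comp_copair)
  then have "copair (Ident C B) (zero X B) \<cdot> ?h =
      copair (Ident C B) (zero (flat B X) B) \<cdot> flat_ker B (flat B X)"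
    by (rule reassoc) (use assms in simp_all)
  then have z: "copair (Ident C B) (zero X B) \<cdot> ?h = zero (flat B (flat B X)) B" using assms by simp
  show "flat_mult B X \<in> hom C (flat B (flat B X)) (flat B X)" "flat_ker B X \<cdot> flat_mult B X = ?h"
    unfolding flat_mult_def using factor_flat_ker[OF assms h z] by simp_all
qed

section \<open>Semidirect products\<close>

text \<open>
  The semidirect product is the quotient of \<open>B + X\<close> that identifies each element of \<open>B \<flat> X\<close> with its
  value under \<open>\<xi>\<close>; for groups these are the relations \<open>b x b\<^sup>-\<^sup>1 = \<xi>(b, x)\<close>. Categorically it is the
  quotient by the image \<open>R\<close> of \<open>f = 1 + \<xi>\<close> and \<open>g = copair inj1 \<kappa>\<close>, two arrows from \<open>B + (B \<flat> X)\<close> to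
  \<open>B + X\<close> with the common section \<open>1 + \<eta>\<close>. So \<open>R\<close> is reflexive, hence the kernel pair of its
  quotient \<open>q\<close>.
  
  The essential point is that \<open>X\<close> is not collapsed in the quotient. Elements \<open>a\<close> and \<open>b\<close> of \<open>X\<close> with
  the same value under \<open>q\<close> are related by \<open>R\<close>, say \<open>a = f(c)\<close> and \<open>b = g(c)\<close>. The projections to \<open>B\<close>
  show that \<open>c\<close> lies in the kernel \<open>B \<flat> (B \<flat> X)\<close>, on which \<open>f\<close> and \<open>g\<close> are \<open>B \<flat> \<xi>\<close> and the
  multiplication \<open>\<mu>\<close> of the monad. The unit and associativity laws of \<open>\<xi>\<close> then give
  \<open>a = \<xi>(a) = \<xi>((B \<flat> \<xi>)(c)) = \<xi>(\<mu>(c)) = \<xi>(b) = b\<close>.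
\<close>

lemma semidirect_product:
  assumes B: "B \<in> Obj C" and act: "is_action B X \<xi>"
  obtains A k s where "normal k" "k \<in> hom C X A" "s \<in> hom C B A"
    "copair s k \<cdot> flat_ker B X = k \<cdot> \<xi>"
proof -
  have xi: "\<xi> \<in> hom C (flat B X) X" and xi_unit: "\<xi> \<cdot> flat_unit B X = Ident C X"
    and xi_mult: "\<xi> \<cdot> flat_mult B X = \<xi> \<cdot> flat_map B \<xi>"
    using act unfolding is_action_def by auto
  have X: "X \<in> Obj C" using xi by auto
  let ?T = "flat B X"
  let ?P = "coprod B X" and ?D = "coprod B ?T"
  let ?i1 = "inj1 B X" and ?i2 = "inj2 B X" and ?\<kappa> = "flat_ker B X"
  let ?j1 = "inj1 B ?T" and ?j2 = "inj2 B ?T" and ?\<kappa>' = "flat_ker B ?T"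
  let ?p = "copair (Ident C B) (zero X B)"
  note obj [simp] = B X
  have xi' [simp]: "\<xi> \<in> Arr C" "Dom C \<xi> = ?T" "Cod C \<xi> = X" using xi by simp_all
  note un = flat_unit[OF B X] and mu = flat_mult[OF B X] and fx = flat_map[OF B xi]
  define f where "f = copair ?i1 (?i2 \<cdot> \<xi>)"
  define g where "g = copair ?i1 ?\<kappa>"
  define \<delta> where "\<delta> = copair ?j1 (?j2 \<cdot> flat_unit B X)"
  have f [simp]: "f \<in> Arr C" "Dom C f = ?D" "Cod C f = ?P"
    and g [simp]: "g \<in> Arr C" "Dom C g = ?D" "Cod C g = ?P"
    and \<delta> [simp]: "\<delta> \<in> Arr C" "Dom C \<delta> = ?P" "Cod C \<delta> = ?D"
    unfolding f_def g_def \<delta>_def using un(1) by simp_all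
  have f\<delta>: "f \<cdot> \<delta> = Ident C ?P"
    by (rule coprod_eqI[where A = B and B = X and Z = ?P])
      (use un(1) xi_unit in \<open>simp_all add: f_def \<delta>_def\<close>)
  have g\<delta>: "g \<cdot> \<delta> = Ident C ?P"
    by (rule coprod_eqI[where A = B and B = X and Z = ?P])
      (use un in \<open>simp_all add: g_def \<delta>_def\<close>)
  have pf: "?p \<cdot> f = copair (Ident C B) (zero ?T B)" and pg: "?p \<cdot> g = copair (Ident C B) (zero ?T B)"
    unfolding f_def g_def by (simp_all add: comp_copair)
  obtain m e where m: "monic m" "m \<in> hom C (Dom C m) (Cod C (pair f g))" and e: "regular_epi e"
    "e \<in> hom C (Dom C (pair f g)) (Dom C m)" "m \<cdot> e = pair f g"
    by (rule image_exists[of "pair f g"]) simp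
  let ?R = "Dom C m"
  have m' [simp]: "m \<in> Arr C" "Cod C m = prod ?P ?P" and e' [simp]: "e \<in> Arr C" "Dom C e = ?D" "Cod C e = ?R"
    using m e by simp_all
  define r where "r = pr1 ?P ?P \<cdot> m"
  define s where "s = pr2 ?P ?P \<cdot> m"
  have r [simp]: "r \<in> Arr C" "Dom C r = ?R" "Cod C r = ?P"
    and s [simp]: "s \<in> Arr C" "Dom C s = ?R" "Cod C s = ?P"
    unfolding r_def s_def by simp_all
  have re: "r \<cdot> e = f" and se: "s \<cdot> e = g"
    unfolding r_def s_def using e(3) by simp_all
  have "pair r s = m"
    by (rule prod_eqI[where A = ?P and B = ?P and Z = ?R]) (simp_all add: r_def s_def)
  then have rs: "monic (pair r s)" using m(1) by simp
  have rd: "r \<cdot> e \<cdot> \<delta> = Ident C ?P" "s \<cdot> e \<cdot> \<delta> = Ident C ?P"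
    by (simp_all add: reassoc[OF re] reassoc[OF se] f\<delta> g\<delta>)
  obtain q where q: "is_coequalizer r s q"
    and q_eff: "\<And>Z a b. \<lbrakk>a \<in> hom C Z ?P; b \<in> hom C Z ?P; q \<cdot> a = q \<cdot> b\<rbrakk> \<Longrightarrow>
      \<exists>c. c \<in> hom C Z ?R \<and> r \<cdot> c = a \<and> s \<cdot> c = b"
    by (rule reflexive_relation_quotient[of r ?R ?P s "e \<cdot> \<delta>"]) (use rs rd in simp_all)
  note Q = coequalizerD[OF q]
  let ?A = "Cod C q"
  have q' [simp]: "q \<in> Arr C" "Dom C q = ?P" using Q by simp_all
  have rq: "regular_epi q" using q unfolding regular_epi_def by blast
  have qfg: "q \<cdot> f = q \<cdot> g"
  proof -
    have "q \<cdot> r \<cdot> e = (q \<cdot> s) \<cdot> e" by (rule reassoc[OF Q(7)]) simp_all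
    then show ?thesis by (simp add: re se)
  qed
  define k where "k = q \<cdot> ?i2"
  have k [simp]: "k \<in> Arr C" "Dom C k = X" "Cod C k = ?A" unfolding k_def by simp_all
  have q\<kappa>: "q \<cdot> ?\<kappa> = k \<cdot> \<xi>"
  proof -
    have "q \<cdot> g \<cdot> ?j2 = (q \<cdot> f) \<cdot> ?j2" by (rule reassoc[OF qfg[symmetric]]) simp_all
    then show ?thesis by (simp add: k_def f_def g_def)
  qed
  \<comment> \<open>Preimages under \<open>e\<close> exist on a cover only, whence \<open>z\<close>.\<close>
  have "monic k"
  proof (rule monicI[OF k(1)])
    fix Z a b assume "a \<in> hom C Z (Dom C k)" "b \<in> hom C Z (Dom C k)" and kab: "k \<cdot> a = k \<cdot> b"
    then have a [simp]: "a \<in> Arr C" "Dom C a = Z" "Cod C a = X"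
      and b [simp]: "b \<in> Arr C" "Dom C b = Z" "Cod C b = X" by simp_all
    have "q \<cdot> ?i2 \<cdot> a = q \<cdot> ?i2 \<cdot> b" using kab unfolding k_def by simp
    with q_eff[of "?i2 \<cdot> a" Z "?i2 \<cdot> b"] obtain c where c: "c \<in> hom C Z ?R"
      and rc: "r \<cdot> c = ?i2 \<cdot> a" and sc: "s \<cdot> c = ?i2 \<cdot> b" by auto
    obtain Z' z c' where z: "regular_epi z" "z \<in> hom C Z' Z" and c': "c' \<in> hom C Z' ?D"
      and ec: "e \<cdot> c' = c \<cdot> z"
      by (rule cover[OF e(1), of c]) (use c in simp_all)
    have z' [simp]: "z \<in> Arr C" "Dom C z = Z'" "Cod C z = Z" using z by simp_all
    have c'' [simp]: "c' \<in> Arr C" "Dom C c' = Z'" "Cod C c' = ?D"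
      and c''' [simp]: "c \<in> Arr C" "Dom C c = Z" "Cod C c = ?R" using c c' by simp_all
    have Z' [simp]: "Z' \<in> Obj C" using Dom_obj[of z] by simp
    have fc: "f \<cdot> c' = ?i2 \<cdot> a \<cdot> z"
    proof -
      have "f \<cdot> c' = r \<cdot> e \<cdot> c'" by (rule reassoc[OF re, symmetric]) simp_all
      also have "\<dots> = (?i2 \<cdot> a) \<cdot> z" unfolding ec by (rule reassoc[OF rc]) simp_all
      finally show ?thesis by simp
    qed
    have gc: "g \<cdot> c' = ?i2 \<cdot> b \<cdot> z"
    proof -
      have "g \<cdot> c' = s \<cdot> e \<cdot> c'" by (rule reassoc[OF se, symmetric]) simp_all
      also have "\<dots> = (?i2 \<cdot> b) \<cdot> z" unfolding ec by (rule reassoc[OF sc]) simp_all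
      finally show ?thesis by simp
    qed
    have "copair (Ident C B) (zero ?T B) \<cdot> c' = ?p \<cdot> f \<cdot> c'"
      by (rule reassoc[OF pf, symmetric]) simp_all
    also have "\<dots> = zero Z' B" unfolding fc by simp
    finally have pc: "copair (Ident C B) (zero ?T B) \<cdot> c' = zero Z' B" .
    obtain t where t: "t \<in> hom C Z' (Dom C ?\<kappa>')" "?\<kappa>' \<cdot> t = c'"
      by (rule kernel_factor[OF is_kernel_flat_ker[of B ?T], of c' Z']) (simp_all add: pc)
    have t' [simp]: "t \<in> Arr C" "Dom C t = Z'" "Cod C t = flat B ?T" using t by simp_all
    have [simp]: "flat_map B \<xi> \<in> Arr C" "Dom C (flat_map B \<xi>) = flat B ?T" "Cod C (flat_map B \<xi>) = ?T"
      "flat_mult B X \<in> Arr C" "Dom C (flat_mult B X) = flat B ?T" "Cod C (flat_mult B X) = ?T"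
      "flat_unit B X \<in> Arr C" "Dom C (flat_unit B X) = X" "Cod C (flat_unit B X) = ?T"
      using fx(1) mu(1) un(1) by simp_all
    have "?\<kappa> \<cdot> flat_map B \<xi> \<cdot> t = (f \<cdot> ?\<kappa>') \<cdot> t"
      by (rule reassoc) (simp_all add: fx(2) f_def)
    also have "\<dots> = f \<cdot> c'" using t(2) by simp
    also have "\<dots> = ?\<kappa> \<cdot> flat_unit B X \<cdot> a \<cdot> z"
      unfolding fc by (simp add: reassoc[OF un(2)])
    finally have t1: "flat_map B \<xi> \<cdot> t = flat_unit B X \<cdot> a \<cdot> z"
      by (rule monicD[OF flat_ker_monic[OF B X]]) simp_all
    have "?\<kappa> \<cdot> flat_mult B X \<cdot> t = (g \<cdot> ?\<kappa>') \<cdot> t"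
      by (rule reassoc) (simp_all add: mu(2) g_def)
    also have "\<dots> = g \<cdot> c'" using t(2) by simp
    also have "\<dots> = ?\<kappa> \<cdot> flat_unit B X \<cdot> b \<cdot> z"
      unfolding gc by (simp add: reassoc[OF un(2)])
    finally have t2: "flat_mult B X \<cdot> t = flat_unit B X \<cdot> b \<cdot> z"
      by (rule monicD[OF flat_ker_monic[OF B X]]) simp_all
    have "a \<cdot> z = \<xi> \<cdot> flat_map B \<xi> \<cdot> t" unfolding t1 by (simp add: reassoc[OF xi_unit])
    also have "\<dots> = (\<xi> \<cdot> flat_mult B X) \<cdot> t" by (rule reassoc[OF xi_mult[symmetric]]) simp_all
    also have "\<dots> = \<xi> \<cdot> flat_mult B X \<cdot> t" by (rule comp_assoc) simp_all
    also have "\<dots> = b \<cdot> z" unfolding t2 by (simp add: reassoc[OF xi_unit])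
    finally show "a = b" by (rule regular_epi_cancel[OF z(1)]) simp_all
  qed
  have "?p \<cdot> r = ?p \<cdot> s"
  proof (rule regular_epi_cancel[OF e(1)])
    show "(?p \<cdot> r) \<cdot> e = (?p \<cdot> s) \<cdot> e" by (simp add: re se pf pg)
  qed simp_all
  then obtain p' where p': "p' \<in> hom C ?A B" and p'q: "p' \<cdot> q = ?p"
    by (rule coequalizer_factor[OF q, of ?p B, rotated 1]) simp_all
  have p'' [simp]: "p' \<in> Arr C" "Dom C p' = ?A" "Cod C p' = B" using p' by simp_all
  \<comment> \<open>An element of the kernel of \<open>p'\<close> lifts to an element of \<open>B \<flat> X\<close>, on which \<open>q\<close> is \<open>k \<cdot> \<xi>\<close>.\<close>
  have "is_kernel p' k"
  proof (rule kernelI[OF p' \<open>monic k\<close>])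
    show "k \<in> hom C X ?A" by simp
    show "p' \<cdot> k = zero X B" unfolding k_def by (simp add: reassoc[OF p'q])
    fix Z h assume h: "h \<in> hom C Z ?A" and ph: "p' \<cdot> h = zero Z B"
    have h' [simp]: "h \<in> Arr C" "Dom C h = Z" "Cod C h = ?A" using h by simp_all
    obtain Z' z h1 where z: "regular_epi z" "z \<in> hom C Z' Z" and h1: "h1 \<in> hom C Z' ?P"
      and qh: "q \<cdot> h1 = h \<cdot> z"
      by (rule cover[OF rq, of h]) (use h in simp_all)
    have z' [simp]: "z \<in> Arr C" "Dom C z = Z'" "Cod C z = Z"
      and h1' [simp]: "h1 \<in> Arr C" "Dom C h1 = Z'" "Cod C h1 = ?P" using z h1 by simp_all
    have "?p \<cdot> h1 = p' \<cdot> q \<cdot> h1" by (rule reassoc[OF p'q, symmetric]) simp_all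
    also have "\<dots> = zero Z B \<cdot> z" unfolding qh by (rule reassoc[OF ph]) simp_all
    finally have ph1: "?p \<cdot> h1 = zero Z' B" by simp
    obtain t where t: "t \<in> hom C Z' (Dom C ?\<kappa>)" "?\<kappa> \<cdot> t = h1"
      by (rule kernel_factor[OF is_kernel_flat_ker[of B X], of h1 Z']) (simp_all add: ph1)
    have t' [simp]: "t \<in> Arr C" "Dom C t = Z'" "Cod C t = ?T" using t by simp_all
    have "h \<cdot> z = q \<cdot> ?\<kappa> \<cdot> t" unfolding t(2) qh ..
    also have "\<dots> = (k \<cdot> \<xi>) \<cdot> t" by (rule reassoc[OF q\<kappa>]) simp_all
    finally have "k \<cdot> \<xi> \<cdot> t = h \<cdot> z" by simp
    then obtain w where "w \<in> hom C (Cod C z) (Dom C k)" "k \<cdot> w = h"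
      by (rule regular_epi_diagonal[OF z(1) \<open>monic k\<close>]) simp_all
    then show "\<exists>u. u \<in> hom C Z X \<and> k \<cdot> u = h" by auto
  qed
  then have "normal k" unfolding normal_def by blast
  moreover have "copair (q \<cdot> ?i1) k = q"
    by (rule coprod_eqI[where A = B and B = X and Z = ?A]) (simp_all add: k_def)
  then have "copair (q \<cdot> ?i1) k \<cdot> ?\<kappa> = k \<cdot> \<xi>" using q\<kappa> by simp
  ultimately show ?thesis by (intro that[of k ?A "q \<cdot> ?i1"]) simp_all
qed

section \<open>Actions restrict to normal subobjects of the semidirect product\<close>

text \<open>
  Since \<open>S\<close> is normal in \<open>A\<close>, conjugation in \<open>A\<close> restricts to \<open>S\<close>: the arrow
  \<open>copair s (k \<cdot> m) \<cdot> \<kappa>\<close> is annihilated by every arrow with kernel \<open>S\<close> and thus factors through \<open>k \<cdot> m\<close>. The laws of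
  an action and compatibility with \<open>\<xi>\<close> can be checked in \<open>A\<close>, where they express
  the definitions of the unit, multiplication and functoriality of the monad.
\<close>

lemma action_restricts:
  assumes B: "B \<in> Obj C" and act: "is_action B X \<xi>"
    and m: "monic m" "m \<in> hom C S X" and k: "monic k" "k \<in> hom C X A" and s: "s \<in> hom C B A"
    and ks: "copair s k \<cdot> flat_ker B X = k \<cdot> \<xi>"
    and norm: "normal (k \<cdot> m)"
  shows "\<exists>\<zeta>. is_action B S \<zeta> \<and> m \<cdot> \<zeta> = \<xi> \<cdot> flat_map B m"
proof -
  have X: "X \<in> Obj C" and S: "S \<in> Obj C" and A: "A \<in> Obj C" using m(2) k(2) by auto
  note obj [simp] = B X S A
  have xi [simp]: "\<xi> \<in> Arr C" "Dom C \<xi> = flat B X" "Cod C \<xi> = X"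
    using act unfolding is_action_def by simp_all
  have [simp]: "m \<in> Arr C" "Dom C m = S" "Cod C m = X" "k \<in> Arr C" "Dom C k = X" "Cod C k = A"
    "s \<in> Arr C" "Dom C s = B" "Cod C s = A"
    using m k s by simp_all
  let ?\<kappa> = "flat_ker B S"
  define n where "n = k \<cdot> m"
  have n [simp]: "n \<in> Arr C" "Dom C n = S" "Cod C n = A" unfolding n_def by simp_all
  obtain f where f: "is_kernel f n" using norm unfolding normal_def n_def by blast
  note F = kernelD[OF f]
  have f' [simp]: "f \<in> Arr C" "Dom C f = A" using F by simp_all
  note n_monic = kernel_monic[OF f]
  have "f \<cdot> copair s n = (f \<cdot> s) \<cdot> copair (Ident C B) (zero S B)"
    using F by (simp add: comp_copair)
  then have "f \<cdot> copair s n \<cdot> ?\<kappa> = ((f \<cdot> s) \<cdot> copair (Ident C B) (zero S B)) \<cdot> ?\<kappa>"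
    by (rule reassoc) simp_all
  then have "f \<cdot> copair s n \<cdot> ?\<kappa> = zero (flat B S) (Cod C f)" by simp
  then obtain \<zeta> where z: "\<zeta> \<in> hom C (flat B S) (Dom C n)" and nz: "n \<cdot> \<zeta> = copair s n \<cdot> ?\<kappa>"
    by (rule kernel_factor[OF f, rotated 1]) simp_all
  have z' [simp]: "\<zeta> \<in> Arr C" "Dom C \<zeta> = flat B S" "Cod C \<zeta> = S" using z by simp_all
  have zh: "\<zeta> \<in> hom C (flat B S) S" by simp
  note un = flat_unit[OF B S] and mu = flat_mult[OF B S] and fz = flat_map[OF B zh]
    and fm = flat_map[OF B m(2)]
  have [simp]: "flat_unit B S \<in> Arr C" "Dom C (flat_unit B S) = S" "Cod C (flat_unit B S) = flat B S"
    "flat_mult B S \<in> Arr C" "Dom C (flat_mult B S) = flat B (flat B S)" "Cod C (flat_mult B S) = flat B S"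
    "flat_map B \<zeta> \<in> Arr C" "Dom C (flat_map B \<zeta>) = flat B (flat B S)" "Cod C (flat_map B \<zeta>) = flat B S"
    "flat_map B m \<in> Arr C" "Dom C (flat_map B m) = flat B S" "Cod C (flat_map B m) = flat B X"
    using un(1) mu(1) fz(1) fm(1) by simp_all
  have unit: "\<zeta> \<cdot> flat_unit B S = Ident C S"
  proof (rule monicD[OF n_monic])
    have "n \<cdot> \<zeta> \<cdot> flat_unit B S = (copair s n \<cdot> ?\<kappa>) \<cdot> flat_unit B S"
      by (rule reassoc[OF nz]) simp_all
    then show "n \<cdot> \<zeta> \<cdot> flat_unit B S = n \<cdot> Ident C S" by (simp add: un(2))
  qed simp_all
  have mult: "\<zeta> \<cdot> flat_mult B S = \<zeta> \<cdot> flat_map B \<zeta>"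
  proof (rule monicD[OF n_monic])
    let ?\<kappa>' = "flat_ker B (flat B S)"
    have "n \<cdot> \<zeta> \<cdot> flat_mult B S = (copair s n \<cdot> ?\<kappa>) \<cdot> flat_mult B S"
      by (rule reassoc[OF nz]) simp_all
    also have "\<dots> = (copair s n \<cdot> copair (inj1 B S) ?\<kappa>) \<cdot> ?\<kappa>'" by (simp add: mu(2))
    also have "copair s n \<cdot> copair (inj1 B S) ?\<kappa> = copair s n \<cdot> copair (inj1 B S) (inj2 B S \<cdot> \<zeta>)"
      by (simp add: comp_copair nz)
    also have "\<dots> \<cdot> ?\<kappa>' = (copair s n \<cdot> ?\<kappa>) \<cdot> flat_map B \<zeta>" by (simp add: fz(2))
    also have "\<dots> = n \<cdot> \<zeta> \<cdot> flat_map B \<zeta>"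
      by (rule reassoc[OF nz, symmetric]) simp_all
    finally show "n \<cdot> \<zeta> \<cdot> flat_mult B S = n \<cdot> \<zeta> \<cdot> flat_map B \<zeta>" .
  qed simp_all
  have "m \<cdot> \<zeta> = \<xi> \<cdot> flat_map B m"
  proof (rule monicD[OF k(1)])
    have "k \<cdot> \<xi> \<cdot> flat_map B m = (copair s k \<cdot> flat_ker B X) \<cdot> flat_map B m"
      by (rule reassoc[OF ks[symmetric]]) simp_all
    also have "\<dots> = (copair s k \<cdot> copair (inj1 B X) (inj2 B X \<cdot> m)) \<cdot> ?\<kappa>" by (simp add: fm(2))
    also have "copair s k \<cdot> copair (inj1 B X) (inj2 B X \<cdot> m) = copair s n"
      by (simp add: comp_copair n_def)
    also have "\<dots> \<cdot> ?\<kappa> = k \<cdot> m \<cdot> \<zeta>" unfolding nz[symmetric] by (simp add: n_def)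
    finally show "k \<cdot> m \<cdot> \<zeta> = k \<cdot> \<xi> \<cdot> flat_map B m" by simp
  qed simp_all
  with unit mult zh show ?thesis unfolding is_action_def by blast
qed

section \<open>Commutators\<close>

lemma higgins_factorization:
  assumes "is_higgins_commutator (Ident C X) (Ident C X) c" "X \<in> Obj C"
  obtains e where "monic c" "c \<in> hom C (Dom C c) X" "regular_epi e"
    "c \<cdot> e = copair (Ident C X) (Ident C X) \<cdot> ker (coprod_to_prod X X)"
    "e \<in> hom C (Dom C (ker (coprod_to_prod X X))) (Dom C c)"
proof -
  let ?j = "ker (coprod_to_prod X X)"
  let ?w = "copair (Ident C X) (Ident C X) \<cdot> ?j"
  have J: "?j \<in> Arr C" "Cod C ?j = coprod X X"
    using kernelD[OF is_kernel_ker[of "coprod_to_prod X X"]] assms by simp_all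
  have w: "?w \<in> Arr C" "Cod C ?w = X" "Dom C ?w = Dom C ?j" using J assms by simp_all
  obtain e where c: "monic c" and e: "e \<in> hom C (Dom C ?w) (Dom C c)" "regular_epi e" "?w = c \<cdot> e"
    using assms unfolding is_higgins_commutator_def is_image_def by auto
  have cA: "c \<in> Arr C" by (rule monic_arr[OF c])
  have e1: "e \<in> hom C (Dom C ?j) (Dom C c)" using e(1) unfolding w(3) .
  have "Cod C (c \<cdot> e) = X" unfolding e(3)[symmetric] by (rule w(2))
  then have "c \<in> hom C (Dom C c) X" using e1 cA by simp
  then show ?thesis by (rule that[OF c _ e(2) e(3)[symmetric] e1])
qed

text \<open>
  The Higgins commutator does not depend on the ambient object: the copairing of \<open>k\<close> with itself
  is \<open>k\<close> after the codiagonal of \<open>X\<close>, so its regular image is computed inside \<open>X\<close>.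
\<close>

lemma higgins_of_monic:
  assumes c: "is_higgins_commutator (Ident C X) (Ident C X) c"
    and k: "monic k" "k \<in> hom C X A"
  shows "is_higgins_commutator k k (k \<cdot> c)"
proof -
  have X [simp]: "X \<in> Obj C" and k' [simp]: "k \<in> Arr C" "Dom C k = X" "Cod C k = A"
    using k by auto
  let ?j = "ker (coprod_to_prod X X)"
  have J: "?j \<in> Arr C" "Cod C ?j = coprod X X"
    using kernelD[OF is_kernel_ker[of "coprod_to_prod X X"]] by simp_all
  obtain e where D: "monic c" "c \<in> hom C (Dom C c) X" "regular_epi e"
    "c \<cdot> e = copair (Ident C X) (Ident C X) \<cdot> ?j" "e \<in> hom C (Dom C ?j) (Dom C c)"
    by (rule higgins_factorization[OF c X])
  have "copair k k = k \<cdot> copair (Ident C X) (Ident C X)" by (simp add: comp_copair)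
  then have eq: "copair k k \<cdot> ?j = k \<cdot> c \<cdot> e" unfolding D(4) using J by simp
  have "is_image (k \<cdot> c \<cdot> e) (k \<cdot> c)" unfolding is_image_def
  proof (intro conjI bexI[of _ e])
    show "monic (k \<cdot> c)" by (rule monic_comp[OF D(1) k(1)]) (use D(2) in simp)
    show "regular_epi e" by (rule D(3))
  qed (use D(2,5) in simp_all)
  then show ?thesis unfolding is_higgins_commutator_def eq[symmetric] by simp
qed

lemma ident_normal:
  assumes "X \<in> Obj C"
  shows "normal (Ident C X)"
proof -
  have "is_kernel (zero X X) (Ident C X)"
  proof (rule kernelI)
    show "monic (Ident C X)" by (rule monicI) (use assms in simp_all)
    fix Z h assume "h \<in> hom C Z X"
    then show "\<exists>u. u \<in> hom C Z X \<and> Ident C X \<cdot> u = h" by auto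
  qed (use assms in simp_all)
  then show ?thesis unfolding normal_def by blast
qed

lemma higgins_normal:
  assumes "NH" "X \<in> Obj C" "is_higgins_commutator (Ident C X) (Ident C X) c"
  shows "normal c"
  using assms ident_normal[OF assms(2)] unfolding NH_def by blast

text \<open>
  Realise the action inside the semidirect product \<open>A\<close>. There \<open>X\<close> is normal, so (NH) makes its
  commutator normal in \<open>A\<close>, and the action restricts to it.
\<close>

lemma higgins_characteristic:
  assumes NH: "NH" and X: "X \<in> Obj C" and c: "is_higgins_commutator (Ident C X) (Ident C X) c"
  shows "characteristic c"
  unfolding characteristic_def
proof (intro conjI ballI allI impI)
  have D: "monic c" "c \<in> hom C (Dom C c) X" by (rule higgins_factorization[OF c X]; assumption)+
  show "monic c" by (rule D)
  fix B \<xi> assume B: "B \<in> Obj C" and act: "is_action B (Cod C c) \<xi>"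
  then have act': "is_action B X \<xi>" using D by simp
  obtain A k s where k: "normal k" "k \<in> hom C X A" and s: "s \<in> hom C B A"
    and eq: "copair s k \<cdot> flat_ker B X = k \<cdot> \<xi>"
    by (rule semidirect_product[OF B act'])
  have km: "monic k" by (rule normal_monic[OF k(1)])
  have "is_higgins_commutator k k (k \<cdot> c)" by (rule higgins_of_monic[OF c km k(2)])
  with NH k(1) have "normal (k \<cdot> c)" unfolding NH_def by blast
  then show "\<exists>\<zeta>. is_action B (Dom C c) \<zeta> \<and> c \<cdot> \<zeta> = \<xi> \<cdot> flat_map B c"
    by (rule action_restricts[OF B act' D km k(2) s eq])
qed

lemma higgins_exists:
  assumes "X \<in> Obj C"
  shows "\<exists>c. is_higgins_commutator (Ident C X) (Ident C X) c"
proof -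
  let ?j = "ker (coprod_to_prod X X)"
  have J: "?j \<in> Arr C" "Cod C ?j = coprod X X"
    using kernelD[OF is_kernel_ker[of "coprod_to_prod X X"]] assms by simp_all
  let ?w = "copair (Ident C X) (Ident C X) \<cdot> ?j"
  have w: "?w \<in> Arr C" using J assms by simp
  obtain m e where m: "monic m" "m \<in> hom C (Dom C m) (Cod C ?w)" "regular_epi e"
    "e \<in> hom C (Dom C ?w) (Dom C m)" "m \<cdot> e = ?w" by (rule image_exists[OF w])
  have "is_image ?w m" unfolding is_image_def
    using w m(1,3,4) m(5)[symmetric] by blast
  then show ?thesis unfolding is_higgins_commutator_def using assms by auto
qed

text \<open>
  Let \<open>q\<close> be the quotient by the commutator. The copairing of \<open>q\<close> with itself vanishes on the
  kernel of the regular epimorphism \<open>X + X \<rightarrow> X \<times> X\<close> and so descends to \<open>\<psi>\<close> on \<open>X \<times> X\<close>, which is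
  \<open>q\<close> on both axes. The kernel of \<open>q \<times> q\<close> is contained in \<open>N \<times> N\<close> with \<open>N\<close> the kernel of \<open>q\<close>, and
  there \<open>\<psi>\<close> vanishes because it does so on the axes. Hence \<open>\<psi>\<close> descends further to \<open>\<phi>\<close> on
  \<open>Q \<times> Q\<close>, and \<open>\<phi>\<close> is the identity on both axes.
\<close>

lemma higgins_commute_modulo:
  assumes X: "X \<in> Obj C" and c: "is_higgins_commutator (Ident C X) (Ident C X) c"
    and norm: "normal c"
  shows "commute_modulo (Ident C X) (Ident C X) c"
proof -
  obtain e where D: "monic c" "c \<in> hom C (Dom C c) X" "regular_epi e"
    "c \<cdot> e = copair (Ident C X) (Ident C X) \<cdot> ker (coprod_to_prod X X)"
    "e \<in> hom C (Dom C (ker (coprod_to_prod X X))) (Dom C c)"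
    by (rule higgins_factorization[OF c X])
  obtain q where q: "is_cokernel c q" by (rule normal_cokernel_exists[OF norm])
  note Q = cokernelD[OF q]
  let ?Q = "Cod C q"
  have rq: "regular_epi q" by (rule cokernel_regular_epi[OF q])
  have q' [simp]: "q \<in> Arr C" "Dom C q = X" using Q D(2) by simp_all
  note [simp] = X
  let ?can = "coprod_to_prod X X"
  let ?j = "ker ?can"
  have j: "is_kernel ?can ?j" by (rule is_kernel_ker) simp
  have J [simp]: "?j \<in> Arr C" "Cod C ?j = coprod X X" using kernelD[OF j] by simp_all
  let ?x1 = "pair (Ident C X) (zero X X)" and ?x2 = "pair (zero X X) (Ident C X)"
    and ?q1 = "pair (Ident C ?Q) (zero ?Q ?Q)" and ?q2 = "pair (zero ?Q ?Q) (Ident C ?Q)"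
  have "copair q q \<cdot> ?j = q \<cdot> c \<cdot> e"
    unfolding D(4) by (simp add: comp_copair reassoc[of q "copair (Ident C X) (Ident C X)"])
  also have "\<dots> = zero (Dom C c) ?Q \<cdot> e" by (rule reassoc[OF Q(4)]) (use D in simp_all)
  also have "\<dots> = zero (Dom C ?j) ?Q" using D(5) by simp
  finally obtain \<psi> where psi: "\<psi> \<in> hom C (Cod C ?can) ?Q" and psi_can: "\<psi> \<cdot> ?can = copair q q"
    by (rule cokernel_factor[OF regular_epi_coker[OF coprod_to_prod_regular_epi[OF X X] j], rotated 1])
      simp_all
  have psi' [simp]: "\<psi> \<in> Arr C" "Dom C \<psi> = prod X X" "Cod C \<psi> = ?Q" using psi by simp_all
  have "\<psi> \<cdot> ?can \<cdot> inj1 X X = copair q q \<cdot> inj1 X X" by (rule reassoc[OF psi_can]) simp_all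
  then have psi1: "\<psi> \<cdot> ?x1 = q" by simp
  have "\<psi> \<cdot> ?can \<cdot> inj2 X X = copair q q \<cdot> inj2 X X" by (rule reassoc[OF psi_can]) simp_all
  then have psi2: "\<psi> \<cdot> ?x2 = q" by simp
  let ?qq = "pair (q \<cdot> pr1 X X) (q \<cdot> pr2 X X)"
  have rqq: "regular_epi ?qq" by (rule square_regular_epi[OF rq]) simp
  obtain d where d: "is_kernel ?qq d" using kernel_exists[of ?qq] by auto
  have d' [simp]: "d \<in> Arr C" "Cod C d = prod X X" using kernelD[OF d] by simp_all
  let ?E = "Dom C d"
  have "pr1 ?Q ?Q \<cdot> ?qq \<cdot> d = zero ?E ?Q" "pr2 ?Q ?Q \<cdot> ?qq \<cdot> d = zero ?E ?Q"
    using kernelD(4)[OF d] by simp_all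
  then have qd: "q \<cdot> pr1 X X \<cdot> d = zero ?E ?Q" "q \<cdot> pr2 X X \<cdot> d = zero ?E ?Q" by simp_all
  obtain n where n: "is_kernel q n" using kernel_exists[of q] by auto
  let ?N = "Dom C n"
  have n' [simp]: "n \<in> Arr C" "Cod C n = X" "q \<cdot> n = zero ?N ?Q" using kernelD[OF n] by simp_all
  obtain d1 where d1: "d1 \<in> hom C ?E ?N" "n \<cdot> d1 = pr1 X X \<cdot> d"
    by (rule kernel_factor[OF n, of "pr1 X X \<cdot> d" ?E]) (simp_all add: qd)
  obtain d2 where d2: "d2 \<in> hom C ?E ?N" "n \<cdot> d2 = pr2 X X \<cdot> d"
    by (rule kernel_factor[OF n, of "pr2 X X \<cdot> d" ?E]) (simp_all add: qd)
  let ?nn = "pair (n \<cdot> pr1 ?N ?N) (n \<cdot> pr2 ?N ?N)"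
  have "?nn \<cdot> pair d1 d2 = d"
    by (rule prod_eqI[where A = X and B = X and Z = ?E]) (use d1 d2 in simp_all)
  moreover have psin: "\<psi> \<cdot> ?nn = zero (prod ?N ?N) ?Q"
  proof (rule product_joint_epi[of ?N ?N])
    have "?nn \<cdot> pair (Ident C ?N) (zero ?N ?N) = ?x1 \<cdot> n"
      by (simp add: pair_comp)
    moreover have "\<psi> \<cdot> ?x1 \<cdot> n = q \<cdot> n" by (rule reassoc[OF psi1]) simp_all
    ultimately show "(\<psi> \<cdot> ?nn) \<cdot> pair (Ident C ?N) (zero ?N ?N) =
        zero (prod ?N ?N) ?Q \<cdot> pair (Ident C ?N) (zero ?N ?N)" by simp
    have "?nn \<cdot> pair (zero ?N ?N) (Ident C ?N) = ?x2 \<cdot> n"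
      by (simp add: pair_comp)
    moreover have "\<psi> \<cdot> ?x2 \<cdot> n = q \<cdot> n" by (rule reassoc[OF psi2]) simp_all
    ultimately show "(\<psi> \<cdot> ?nn) \<cdot> pair (zero ?N ?N) (Ident C ?N) =
        zero (prod ?N ?N) ?Q \<cdot> pair (zero ?N ?N) (Ident C ?N)" by simp
  qed simp_all
  have "\<psi> \<cdot> ?nn \<cdot> pair d1 d2 = zero (prod ?N ?N) ?Q \<cdot> pair d1 d2"
    by (rule reassoc[OF psin]) (use d1 d2 in simp_all)
  ultimately have "\<psi> \<cdot> d = zero ?E ?Q" using d1 d2 by simp
  then obtain \<phi> where phi: "\<phi> \<in> hom C (Cod C ?qq) ?Q" and phi_qq: "\<phi> \<cdot> ?qq = \<psi>"
    by (rule cokernel_factor[OF regular_epi_coker[OF rqq d], rotated 1]) simp_all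
  have phi' [simp]: "\<phi> \<in> Arr C" "Dom C \<phi> = prod ?Q ?Q" "Cod C \<phi> = ?Q" using phi by simp_all
  have phi1: "\<phi> \<cdot> ?q1 = Ident C ?Q"
  proof (rule regular_epi_cancel[OF rq])
    have "?qq \<cdot> ?x1 = ?q1 \<cdot> q" by (simp add: pair_comp)
    moreover have "\<phi> \<cdot> ?qq \<cdot> ?x1 = \<psi> \<cdot> ?x1" by (rule reassoc[OF phi_qq]) simp_all
    ultimately show "(\<phi> \<cdot> ?q1) \<cdot> q = Ident C ?Q \<cdot> q" by (simp add: psi1)
  qed simp_all
  have phi2: "\<phi> \<cdot> ?q2 = Ident C ?Q"
  proof (rule regular_epi_cancel[OF rq])
    have "?qq \<cdot> ?x2 = ?q2 \<cdot> q" by (simp add: pair_comp)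
    moreover have "\<phi> \<cdot> ?qq \<cdot> ?x2 = \<psi> \<cdot> ?x2" by (rule reassoc[OF phi_qq]) simp_all
    ultimately show "(\<phi> \<cdot> ?q2) \<cdot> q = Ident C ?Q \<cdot> q" by (simp add: psi2)
  qed simp_all
  have "Ident C ?Q \<in> hom C ?Q ?Q" "\<phi> \<in> hom C (prod ?Q ?Q) ?Q" by simp_all
  with phi1 phi2 have "commute (Ident C ?Q) (Ident C ?Q)" unfolding commute_def by blast
  moreover have "is_image (q \<cdot> Ident C X) (Ident C ?Q)" unfolding is_image_def
  proof (intro conjI bexI[of _ q])
    show "monic (Ident C ?Q)" by (rule monicI) simp_all
    show "regular_epi q" by (rule rq)
  qed simp_all
  ultimately show ?thesis unfolding commute_modulo_def using q by blast
qed

text \<open>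
  Let \<open>q\<close> be the cokernel of \<open>n\<close>, and write it as \<open>k' \<cdot> ek\<close> and as \<open>l' \<cdot> el\<close> with \<open>k'\<close> and \<open>l'\<close>
  commuting. Then the copairing of \<open>q\<close> with itself factors through \<open>X + X \<rightarrow> X \<times> X\<close>. So \<open>q\<close>
  annihilates the commutator, which therefore lies in the kernel \<open>n\<close> of \<open>q\<close>.
\<close>

lemma higgins_least:
  assumes X: "X \<in> Obj C" and c: "is_higgins_commutator (Ident C X) (Ident C X) c"
    and n: "normal n" "Cod C n = X" and cm: "commute_modulo (Ident C X) (Ident C X) n"
  shows "subobj_le c n"
proof -
  note [simp] = X
  obtain e where D: "monic c" "c \<in> hom C (Dom C c) X" "regular_epi e"
    "c \<cdot> e = copair (Ident C X) (Ident C X) \<cdot> ker (coprod_to_prod X X)"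
    "e \<in> hom C (Dom C (ker (coprod_to_prod X X))) (Dom C c)"
    by (rule higgins_factorization[OF c X])
  obtain q k' l' where q: "is_cokernel n q" and k': "is_image (q \<cdot> Ident C X) k'"
    and l': "is_image (q \<cdot> Ident C X) l'" and kl: "commute k' l'"
    using cm unfolding commute_modulo_def by blast
  note Q = cokernelD[OF q]
  let ?Q = "Cod C q"
  have q' [simp]: "q \<in> Arr C" "Dom C q = X" using Q n by simp_all
  obtain ek where ek: "ek \<in> hom C X (Dom C k')" "q = k' \<cdot> ek"
    using k' unfolding is_image_def by auto
  obtain el where el: "el \<in> hom C X (Dom C l')" "q = l' \<cdot> el"
    using l' unfolding is_image_def by auto
  obtain K L E \<phi> where ty: "k' \<in> hom C K E" "l' \<in> hom C L E" and phi: "\<phi> \<in> hom C (prod K L) E"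
    and p1: "\<phi> \<cdot> pair (Ident C K) (zero K L) = k'" and p2: "\<phi> \<cdot> pair (zero L K) (Ident C L) = l'"
    using kl unfolding commute_def by blast
  have "E = Cod C (k' \<cdot> ek)" using ty ek(1) by simp
  then have E: "E = ?Q" unfolding ek(2)[symmetric] .
  have [simp]: "k' \<in> Arr C" "Dom C k' = K" "Cod C k' = ?Q" "l' \<in> Arr C" "Dom C l' = L" "Cod C l' = ?Q"
    "\<phi> \<in> Arr C" "Dom C \<phi> = prod K L" "Cod C \<phi> = ?Q" using ty phi E by simp_all
  have [simp]: "ek \<in> Arr C" "Dom C ek = X" "Cod C ek = K" "el \<in> Arr C" "Dom C el = X" "Cod C el = L"
    using ek(1) el(1) by simp_all
  have [simp]: "K \<in> Obj C" "L \<in> Obj C" by (rule hom_objs[OF ty(1)], rule hom_objs[OF ty(2)])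
  let ?can = "coprod_to_prod X X"
  let ?j = "ker ?can"
  have j: "is_kernel ?can ?j" by (rule is_kernel_ker) simp
  have J [simp]: "?j \<in> Arr C" "Cod C ?j = coprod X X" using kernelD[OF j] by simp_all
  let ?\<theta> = "\<phi> \<cdot> pair (ek \<cdot> pr1 X X) (el \<cdot> pr2 X X)"
  have th1: "?\<theta> \<cdot> pair (Ident C X) (zero X X) = q"
  proof -
    have "?\<theta> \<cdot> pair (Ident C X) (zero X X) = \<phi> \<cdot> pair (Ident C K) (zero K L) \<cdot> ek"
      by (simp add: pair_comp)
    also have "\<dots> = k' \<cdot> ek" by (rule reassoc[OF p1]) simp_all
    finally show ?thesis unfolding ek(2)[symmetric] .
  qed
  have th2: "?\<theta> \<cdot> pair (zero X X) (Ident C X) = q"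
  proof -
    have "?\<theta> \<cdot> pair (zero X X) (Ident C X) = \<phi> \<cdot> pair (zero L K) (Ident C L) \<cdot> el"
      by (simp add: pair_comp)
    also have "\<dots> = l' \<cdot> el" by (rule reassoc[OF p2]) simp_all
    finally show ?thesis unfolding el(2)[symmetric] .
  qed
  have th: "?\<theta> \<in> Arr C" "Dom C ?\<theta> = prod X X" "Cod C ?\<theta> = ?Q" by simp_all
  have "?\<theta> \<cdot> ?can = copair q q"
    unfolding coprod_to_prod_def by (subst comp_copair) (use th th1 th2 in \<open>simp_all del: comp_assoc\<close>)
  also have "\<dots> = q \<cdot> copair (Ident C X) (Ident C X)" by (simp add: comp_copair)
  finally have "q \<cdot> copair (Ident C X) (Ident C X) = ?\<theta> \<cdot> ?can" ..
  then have "q \<cdot> copair (Ident C X) (Ident C X) \<cdot> ?j = (?\<theta> \<cdot> ?can) \<cdot> ?j"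
    by (rule reassoc) simp_all
  also have "\<dots> = ?\<theta> \<cdot> ?can \<cdot> ?j" by (rule comp_assoc) simp_all
  also have "\<dots> = ?\<theta> \<cdot> zero (Dom C ?j) (prod X X)" using kernelD(4)[OF j] by simp
  also have "\<dots> = zero (Dom C ?j) ?Q" by simp
  finally have qce: "q \<cdot> c \<cdot> e = zero (Dom C ?j) ?Q" unfolding D(4) .
  have c' [simp]: "c \<in> Arr C" "Cod C c = X" "e \<in> Arr C" "Dom C e = Dom C ?j" "Cod C e = Dom C c"
    using D by simp_all
  have "q \<cdot> c = zero (Dom C c) ?Q"
    by (rule regular_epi_cancel[OF D(3)]) (use qce in simp_all)
  then obtain u where u: "u \<in> hom C (Dom C c) (Dom C n)" "n \<cdot> u = c"
    by (rule kernel_factor[OF normal_kernel_of_cokernel[OF n(1) q], rotated 1]) simp_all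
  then show ?thesis unfolding subobj_le_def by blast
qed

lemma higgins_huq:
  assumes NH: "NH" and X: "X \<in> Obj C" and c: "is_higgins_commutator (Ident C X) (Ident C X) c"
  shows "is_huq_commutator (Ident C X) (Ident C X) c"
proof -
  have D: "monic c" "c \<in> hom C (Dom C c) X" by (rule higgins_factorization[OF c X]; assumption)+
  have n: "normal c" by (rule higgins_normal[OF NH X c])
  show ?thesis unfolding is_huq_commutator_def
    using D(2) X n higgins_commute_modulo[OF X c n] higgins_least[OF X c] by simp
qed

lemma higgins_subobject_eq:
  assumes X: "X \<in> Obj C" and c: "is_higgins_commutator (Ident C X) (Ident C X) c"
    and d: "monic d" and cd: "subobj_le c d" and dc: "subobj_le d c"
  shows "is_higgins_commutator (Ident C X) (Ident C X) d"
proof -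
  obtain e where D: "monic c" "c \<in> hom C (Dom C c) X" "regular_epi e"
    "c \<cdot> e = copair (Ident C X) (Ident C X) \<cdot> ker (coprod_to_prod X X)"
    "e \<in> hom C (Dom C (ker (coprod_to_prod X X))) (Dom C c)"
    by (rule higgins_factorization[OF c X])
  obtain u where u: "u \<in> hom C (Dom C c) (Dom C d)" "d \<cdot> u = c" using cd unfolding subobj_le_def by blast
  obtain v where v: "v \<in> hom C (Dom C d) (Dom C c)" "c \<cdot> v = d" using dc unfolding subobj_le_def by blast
  have dA: "d \<in> Arr C" by (rule monic_arr[OF d])
  have "c \<cdot> v \<cdot> u = d \<cdot> u" by (rule reassoc[OF v(2)]) (use u v D in simp_all)
  then have vu: "v \<cdot> u = Ident C (Dom C c)"
    by (intro monicD[OF D(1), of "v \<cdot> u" "Ident C (Dom C c)"]) (use u v D in simp_all)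
  have "d \<cdot> u \<cdot> v = c \<cdot> v" by (rule reassoc[OF u(2)]) (use u v dA in simp_all)
  then have uv: "u \<cdot> v = Ident C (Dom C d)"
    by (intro monicD[OF d, of "u \<cdot> v" "Ident C (Dom C d)"]) (use u v dA in simp_all)
  have iu: "iso u" unfolding iso_def using u v uv vu by auto
  have re: "regular_epi (u \<cdot> e)" by (rule regular_epi_iso_comp[OF D(3) iu]) (use u D in simp)
  let ?w = "copair (Ident C X) (Ident C X) \<cdot> ker (coprod_to_prod X X)"
  have w: "?w \<in> Arr C" "Dom C ?w = Dom C e" unfolding D(4)[symmetric] using D(2,5) by simp_all
  have "d \<cdot> u \<cdot> e = ?w" unfolding D(4)[symmetric] by (rule reassoc[OF u(2)]) (use u D dA in simp_all)
  moreover have "u \<cdot> e \<in> hom C (Dom C ?w) (Dom C d)" using w u D(5) by simp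
  ultimately have "is_image ?w d" unfolding is_image_def using w(1) d re by metis
  then show ?thesis unfolding is_higgins_commutator_def using X by simp
qed

lemma huq_higgins:
  assumes NH: "NH" and X: "X \<in> Obj C" and d: "is_huq_commutator (Ident C X) (Ident C X) d"
  shows "is_higgins_commutator (Ident C X) (Ident C X) d"
proof -
  obtain c where c: "is_higgins_commutator (Ident C X) (Ident C X) c" using higgins_exists[OF X] ..
  have c': "is_huq_commutator (Ident C X) (Ident C X) c" by (rule higgins_huq[OF NH X c])
  show ?thesis
  proof (rule higgins_subobject_eq[OF X c])
    show "monic d" using d normal_monic(1) unfolding is_huq_commutator_def by blast
    show "subobj_le c d" "subobj_le d c" using c' d unfolding is_huq_commutator_def by blast+
  qed
qed

end

theorem corollary3p4:
  fixes C :: "('o, 'm) cat" and X :: 'o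
  assumes "semi_abelian_category C"
    and "category.NH C"
    and "X \<in> Obj C"
  shows "(\<exists>c. category.is_higgins_commutator C (Ident C X) (Ident C X) c) \<and>
    (\<forall>c. category.is_higgins_commutator C (Ident C X) (Ident C X) c \<longleftrightarrow>
      category.is_huq_commutator C (Ident C X) (Ident C X) c) \<and>
    (\<forall>c. category.is_higgins_commutator C (Ident C X) (Ident C X) c \<longrightarrow>
      Cod C c = X \<and> category.characteristic C c)"
proof -
  interpret semi_abelian_category C by (rule assms(1))
  show ?thesis
  proof (intro conjI allI impI iffI)
    fix c assume c: "is_higgins_commutator (Ident C X) (Ident C X) c"
    show "Cod C c = X" by (rule higgins_factorization[OF c assms(3)]) simp
  qed (use assms(2,3) higgins_exists higgins_huq huq_higgins higgins_characteristic in blast)+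
qed

end
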